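(* Given $k\ge2$, $d>0$, $\pi$, $p$, let $G^\star\sim\mathcal{G}_{plant}(n,d,p,\pi)$ with planted labels $\sigma^\star$. The following are equivalent: (a) Weak recovery is impossible at $d$, that is, $\lim_{n\to\infty}\mathbb{E}[A(\sigma^\star,\hat\sigma)]=\frac1q$ for any sequence of estimators $\hat\sigma=\hat\sigma_n(G^\star)\in[q]^V$. (b) For any two distinct variables $u\ne v$ and $i,j\in[q]$, as $n\to\infty$, $\mathbb{P}(\sigma^\star_u=i,\sigma^\star_v=j\mid G^\star)\to\pi_i\pi_j$ in probability. (c) For any two distinct variables $u\neq v$, $\mathbb{P}(\sigma^\star_u=\sigma^\star_v\mid G^\star)\to\sum_{i=1}^q\pi_i^2$ in probability and $\sum_{i=1}^q\pi_i\mathbb{P}(\sigma^\star_u=i\mid G^\star)\to\sum_{i=1}^q\pi_i^2$ in probability. (d) The overlap matrix of two samples from the posterior is trivial: as $n\to\infty$, $\mathbb{E}\big\langle\|R_{\sigma^1,\sigma^2}-\pi\pi^T\|_1\big\rangle_{G^\star}\to0$.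
   Context: Setting. Fix integers $q,k\ge2$, a probability vector $\pi$ on $[q]=\{1,\dots,q\}$ with $\pi_i>0$, a finite set $\Psi$ of functions $\psi:[q]^k\to(0,\infty)$, and a probability measure $p$ on $\Psi$ with full support, such that for every $\psi\in\Psi$ and $\theta\in S_k$ the function $\psi^\theta(\sigma_1,\dots,\sigma_k)=\psi(\sigma_{\theta(1)},\dots,\sigma_{\theta(k)})$ is in $\Psi$ and $p(\psi^\theta)=p(\psi)$. A factor graph has variables $V=\{v_1,\dots,v_n\}$ and clauses $F=\{a_1,\dots,a_m\}$; each clause $a$ has an ordered neighborhood $\delta a\in V^k$ and a weight function $\psi_a\in\Psi$; $\psi_G(\sigma)=\prod_{a\in F}\psi_a(\sigma_{\delta a})$. Null model $G(n,m)$: the $\delta a$ are i.i.d. uniform on $V^k$ and the $\psi_a$ i.i.d. from $p$, independently. Planted model $G^\star(n,m)$: draw $\sigma^\star\sim\pi^{\otimes V}$, then $\mathbb{P}(G^\star(n,m)=g\mid\sigma^\star=\sigma)=\mathbb{P}(G(n,m)=g)\,\psi_g(\sigma)/\mathbb{E}[\psi_{G(n,m)}(\sigma)]$. $\mathcal{G}_{plant}(n,d,p,\pi)$ is the law of $G^\star=G^\star(n,\mathbf{m})$ with an independent $\mathbf{m}\sim\mathrm{Poisson}(dn/k)$. Overlap: $A(\sigma^1,\sigma^2)=\max_{\Gamma\in S_q}\frac1q\sum_{i=1}^q\frac{|\{v:\sigma^1_v=i,\sigma^2_v=\Gamma(i)\}|}{|\{v:\sigma^1_v=i\}|}$ (terms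 with zero denominator are $0$). Overlap matrix: $R_{\sigma^1,\sigma^2}(i,j)=\frac1n\sum_{v\in V}\mathbf{1}\{\sigma^1_v=i,\sigma^2_v=j\}$, $i,j\in[q]$. $\langle\cdot\rangle_{G}$ denotes expectation over i.i.d. samples $\sigma^1,\sigma^2,\dots$ from the posterior $\mu_G(\sigma)=\mathbb{P}(\sigma^\star=\sigma\mid G^\star=G)$, and $\|\cdot\|_1$ is the entrywise $\ell_1$ norm. *)

theory Defs
  imports "HOL-Probability.Probability"
begin

text \<open>
  The label set \<open>[q]\<close> and the index set \<open>[k]\<close> of a clause are finite types \<open>'q\<close> and \<open>'k\<close>, so
  \<open>q = CARD('q)\<close> and \<open>k = CARD('k)\<close>. The variables are \<open>V = {..<n}\<close>. A labelling of \<open>V\<close> is a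
  function \<open>nat \<Rightarrow> 'q\<close> whose values outside \<open>V\<close> are never inspected. A clause is a pair
  \<open>(\<delta>a, \<psi>\<^sub>a)\<close> and a factor graph is the list of its clauses.
\<close>

type_synonym ('q, 'k) weight_fun = "('k \<Rightarrow> 'q) \<Rightarrow> real"
type_synonym ('q, 'k) factor_graph = "(('k \<Rightarrow> nat) \<times> ('q, 'k) weight_fun) list"

definition graph_weight :: "('q, 'k) factor_graph \<Rightarrow> (nat \<Rightarrow> 'q) \<Rightarrow> real" where
  "graph_weight G \<sigma> = (\<Prod>(\<delta>, \<psi>)\<leftarrow>G. \<psi> (\<sigma> \<circ> \<delta>))"

definition null_model ::
    "nat \<Rightarrow> nat \<Rightarrow> ('q::finite, 'k::finite) weight_fun pmf \<Rightarrow> ('q, 'k) factor_graph pmf" where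
  "null_model n m p =
     replicate_pmf m (pair_pmf (pmf_of_set {\<delta>. range \<delta> \<subseteq> {..<n}}) p)"

text \<open>
  The law of \<open>G\<^sup>\<star>(n,m)\<close> given \<open>\<sigma>\<^sup>\<star> = \<sigma>\<close>. The argument of \<open>embed_pmf\<close> is a
  probability mass function whenever \<open>n > 0\<close> and \<open>p\<close> is finitely supported on positive
  functions; see \<open>pmf_planted_graph\<close> below.
\<close>

definition planted_graph ::
    "nat \<Rightarrow> nat \<Rightarrow> ('q::finite, 'k::finite) weight_fun pmf \<Rightarrow> (nat \<Rightarrow> 'q) \<Rightarrow> ('q, 'k) factor_graph pmf"
  where
  "planted_graph n m p \<sigma> =
     embed_pmf (\<lambda>g. pmf (null_model n m p) g * graph_weight g \<sigma>
                  / measure_pmf.expectation (null_model n m p) (\<lambda>G. graph_weight G \<sigma>))"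

text \<open>
  The joint law of \<open>(\<sigma>\<^sup>\<star>, G\<^sup>\<star>)\<close> with \<open>G\<^sup>\<star> = G\<^sup>\<star>(n, \<^bold>m)\<close>. Only \<open>n > 0\<close> is meaningful,
  which is irrelevant for limits as \<open>n\<close> tends to infinity.
\<close>

definition planted_model ::
    "nat \<Rightarrow> real \<Rightarrow> ('q::finite, 'k::finite) weight_fun pmf \<Rightarrow> 'q pmf
      \<Rightarrow> ((nat \<Rightarrow> 'q) \<times> ('q, 'k) factor_graph) pmf" where
  "planted_model n d p \<pi> = do {
     \<sigma> \<leftarrow> Pi_pmf {..<n} undefined (\<lambda>_. \<pi>);
     m \<leftarrow> poisson_pmf (d * real n / real CARD('k));
     G \<leftarrow> planted_graph n m p \<sigma>;
     return_pmf (\<sigma>, G)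
   }"

definition G_plant ::
    "nat \<Rightarrow> real \<Rightarrow> ('q::finite, 'k::finite) weight_fun pmf \<Rightarrow> 'q pmf \<Rightarrow> ('q, 'k) factor_graph pmf"
  where
  "G_plant n d p \<pi> = map_pmf snd (planted_model n d p \<pi>)"

text \<open>
  The posterior \<open>\<mu>\<^sub>G\<close>, i.e. the law of \<open>\<sigma>\<^sup>\<star>\<close> given \<open>G\<^sup>\<star> = G\<close>. It is unspecified if \<open>G\<close> is not in
  the support of \<open>G_plant\<close>.
\<close>

definition posterior ::
    "nat \<Rightarrow> real \<Rightarrow> ('q::finite, 'k::finite) weight_fun pmf \<Rightarrow> 'q pmf \<Rightarrow> ('q, 'k) factor_graph
      \<Rightarrow> (nat \<Rightarrow> 'q) pmf" where
  "posterior n d p \<pi> G =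
     map_pmf fst (cond_pmf (planted_model n d p \<pi>) {x. snd x = G})"

text \<open>Division by zero yields \<open>0\<close>, as required for the classes not used by \<open>\<sigma>1\<close>.\<close>

definition overlap :: "nat \<Rightarrow> (nat \<Rightarrow> 'q::finite) \<Rightarrow> (nat \<Rightarrow> 'q) \<Rightarrow> real" where
  "overlap n \<sigma>1 \<sigma>2 =
     (MAX \<Gamma> \<in> {\<Gamma>. \<Gamma> permutes (UNIV :: 'q set)}.
        1 / real CARD('q) *
          (\<Sum>i\<in>UNIV. real (card {v. v < n \<and> \<sigma>1 v = i \<and> \<sigma>2 v = \<Gamma> i})
                    / real (card {v. v < n \<and> \<sigma>1 v = i})))"

definition overlap_matrix :: "nat \<Rightarrow> (nat \<Rightarrow> 'q) \<Rightarrow> (nat \<Rightarrow> 'q) \<Rightarrow> 'q \<Rightarrow> 'q \<Rightarrow> real" where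
  "overlap_matrix n \<sigma>1 \<sigma>2 i j = real (card {v. v < n \<and> \<sigma>1 v = i \<and> \<sigma>2 v = j}) / real n"

definition weak_recovery_impossible ::
    "real \<Rightarrow> ('q::finite, 'k::finite) weight_fun pmf \<Rightarrow> 'q pmf \<Rightarrow> bool" where
  "weak_recovery_impossible d p \<pi> \<longleftrightarrow>
     (\<forall>est :: nat \<Rightarrow> ('q, 'k) factor_graph \<Rightarrow> nat \<Rightarrow> 'q.
        (\<lambda>n. measure_pmf.expectation (planted_model n d p \<pi>) (\<lambda>(\<sigma>, G). overlap n \<sigma> (est n G)))
          \<longlonglongrightarrow> 1 / real CARD('q))"

text \<open>Convergence in probability to a constant, for random variables \<open>X n\<close> on varying spaces \<open>M n\<close>.\<close>

definition tendsto_in_prob :: "(nat \<Rightarrow> 'a pmf) \<Rightarrow> (nat \<Rightarrow> 'a \<Rightarrow> real) \<Rightarrow> real \<Rightarrow> bool" where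
  "tendsto_in_prob M X c \<longleftrightarrow>
     (\<forall>\<epsilon>>0. (\<lambda>n. measure_pmf.prob (M n) {x. \<bar>X n x - c\<bar> > \<epsilon>}) \<longlonglongrightarrow> 0)"

text \<open>A choice, for every \<open>n \<ge> 2\<close>, of two distinct variables of \<open>V = {..<n}\<close>.\<close>

definition distinct_variables :: "(nat \<Rightarrow> nat) \<Rightarrow> (nat \<Rightarrow> nat) \<Rightarrow> bool" where
  "distinct_variables u v \<longleftrightarrow> (\<forall>n\<ge>2. u n < n \<and> v n < n \<and> u n \<noteq> v n)"

lemma pmf_embed_pmf_reweighted:
  fixes M :: "'a pmf"
  assumes fin: "finite (set_pmf M)" and pos: "\<And>x. x \<in> set_pmf M \<Longrightarrow> f x > (0::real)"
  shows "pmf (embed_pmf (\<lambda>x. pmf M x * f x / measure_pmf.expectation M f)) y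
           = pmf M y * f y / measure_pmf.expectation M f"
proof -
  define Z where "Z = measure_pmf.expectation M f"
  have Z: "Z = (\<Sum>x\<in>set_pmf M. pmf M x * f x)"
    unfolding Z_def using fin by (simp add: integral_measure_pmf_real[of "set_pmf M"] mult.commute)
  have Z0: "Z > 0"
    unfolding Z using fin pos by (intro sum_pos) (auto simp: set_pmf_not_empty pmf_positive)
  have nn: "0 \<le> pmf M x * f x / Z" for x
    using pos[of x] Z0 by (cases "x \<in> set_pmf M") (auto simp: set_pmf_iff less_imp_le)
  have "(\<integral>\<^sup>+x. ennreal (pmf M x * f x / Z) \<partial>count_space UNIV)
          = (\<Sum>x\<in>set_pmf M. ennreal (pmf M x * f x / Z))"
    by (rule nn_integral_count_space'[OF fin]) (auto simp: set_pmf_iff)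
  also have "\<dots> = ennreal (\<Sum>x\<in>set_pmf M. pmf M x * f x / Z)"
    using nn by (simp add: sum_ennreal)
  also have "(\<Sum>x\<in>set_pmf M. pmf M x * f x / Z) = 1"
    using Z0 by (simp flip: sum_divide_distrib Z)
  finally have "(\<integral>\<^sup>+x. ennreal (pmf M x * f x / Z) \<partial>count_space UNIV) = 1" by simp
  with nn show ?thesis
    unfolding Z_def by (intro pmf_embed_pmf) auto
qed

lemma pmf_planted_graph:
  fixes p :: "('q::finite, 'k::finite) weight_fun pmf"
  assumes "n > 0" and "finite (set_pmf p)" and "\<And>\<psi> s. \<psi> \<in> set_pmf p \<Longrightarrow> \<psi> s > 0"
  shows "pmf (planted_graph n m p \<sigma>) g =
           pmf (null_model n m p) g * graph_weight g \<sigma>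
             / measure_pmf.expectation (null_model n m p) (\<lambda>G. graph_weight G \<sigma>)"
  unfolding planted_graph_def
proof (rule pmf_embed_pmf_reweighted)
  let ?D = "{\<delta> :: 'k \<Rightarrow> nat. range \<delta> \<subseteq> {..<n}}"
  have "?D = (\<Pi>\<^sub>E i\<in>UNIV. {..<n})" by (auto simp: PiE_def Pi_def)
  hence D: "finite ?D" "?D \<noteq> {}"
    using \<open>n > 0\<close> by (auto intro!: finite_PiE exI[of _ "\<lambda>_. 0"])
  have supp: "set_pmf (null_model n m p) = {G. set G \<subseteq> ?D \<times> set_pmf p \<and> length G = m}"
    unfolding null_model_def by (auto simp: set_replicate_pmf D set_pmf_of_set[OF D(2,1)] lists_eq_set)
  show "finite (set_pmf (null_model n m p))"
    unfolding supp using D assms by (intro finite_lists_length_eq) auto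
  fix G assume "G \<in> set_pmf (null_model n m p)"
  hence "set G \<subseteq> ?D \<times> set_pmf p" by (simp add: supp)
  thus "graph_weight G \<sigma> > 0"
    unfolding graph_weight_def using assms(3) by (induction G) auto
qed

end

theory Submission
  imports Defs
begin

text \<open>
  Everything is reduced to the law of two replicas: two independent posterior samples
  \<open>\<sigma>\<^sup>1, \<sigma>\<^sup>2\<close> for a common observed graph. Each replica by itself has the law of the planted
  labelling, a product of \<open>\<pi>\<close>, and the pair is invariant under permutations of the variables,
  because relabelling the variables of a factor graph preserves the model
  (\<open>planted_model_relabel\<close>, \<open>replicas_invariant\<close>).

  If the posterior mean of a bounded statistic \<open>h\<close> has expectation \<open>c\<close>, then it tends to \<open>c\<close> in
  probability exactly when its second moment tends to \<open>c\<^sup>2\<close>, and this second moment is the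
  replica expectation of \<open>h(\<sigma>\<^sup>1) h(\<sigma>\<^sup>2)\<close> (\<open>posterior_in_prob_iff\<close>). By exchangeability, the replica
  expectation of a function of the labels at two fixed distinct variables agrees up to \<open>O(1/n)\<close>
  with its average over all pairs of variables, which is a quadratic form in the overlap matrix
  \<open>R\<close> (\<open>Rep_pair_average\<close>, \<open>pair_average_eq\<close>). Hence triviality of \<open>R\<close>, which is (d), yields (b)
  (\<open>trivial_overlap_imp_pair_posterior\<close>). Summing (b) over labels yields (c)
  (\<open>pair_posterior_imp_collision\<close>). Conversely, with \<open>s = \<Sum>\<^sub>i \<pi>\<^sub>i\<^sup>2\<close>,
  the squared Frobenius distance of \<open>R\<close> from \<open>\<pi>\<pi>\<^sup>T\<close> is, up to \<open>O(1/n)\<close> in expectation, the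
  collision second moment minus twice the second moment of the second statistic of (c) plus
  \<open>s\<^sup>2\<close>. Under (c) this tends to \<open>s\<^sup>2 - 2s\<^sup>2 + s\<^sup>2 = 0\<close> (\<open>collision_imp_trivial_overlap\<close>).

  For weak recovery, the overlap \<open>A\<close> depends only on the overlap matrix of truth and estimate.
  If that matrix is close to \<open>\<pi>\<tau>\<^sup>T\<close>, with \<open>\<tau>\<close> the label frequencies of the estimate, then all
  permutations score about \<open>1/q\<close>, so \<open>A\<close> is close to \<open>1/q\<close>
  (\<open>max_alignment_near_trivial\<close>). Conversely, the average score over all permutations is about
  \<open>1/q\<close>; so if the best score is about \<open>1/q\<close>, every score is, and comparing permutations that
  differ by one transposition forces the matrix to be close to \<open>\<pi>\<tau>\<^sup>T\<close>
  (\<open>near_trivial_of_max_alignment\<close>).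

  From (d) to (a): an estimate is constant under the posterior, and by Cauchy-Schwarz the fourth
  power of the \<open>L\<^sup>1\<close> distance between \<open>\<pi>\<tau>\<^sup>T\<close> and the overlap matrix of truth and estimate, entry
  by entry, is bounded by the quantity in (d), uniformly over estimators (\<open>estimator_decorrelation\<close>). From (a) to
  (d): guessing with a posterior sample is a randomized estimator, so some deterministic estimator
  does at least as well (\<open>exists_estimator_beating_replica\<close>). Impossibility of recovery then
  bounds the expected overlap of two replicas by \<open>1/q + o(1)\<close>, and the converse above together with
  the law of large numbers for the label frequencies gives (d).
\<close>

section \<open>Expectations of bounded functions and convergence in probability\<close>

lemma integrable_pmf_bounded:
  fixes f :: "'a \<Rightarrow> real"
  assumes "\<And>x. x \<in> set_pmf M \<Longrightarrow> \<bar>f x\<bar> \<le> B"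
  shows "integrable (measure_pmf M) f"
  by (rule measure_pmf.integrable_const_bound[where B=B]) (use assms in \<open>auto simp: AE_measure_pmf_iff\<close>)

lemma abs_expectation_le:
  fixes f :: "'a \<Rightarrow> real"
  assumes "\<And>x. x \<in> set_pmf M \<Longrightarrow> \<bar>f x\<bar> \<le> B"
  shows "\<bar>measure_pmf.expectation M f\<bar> \<le> B"
proof -
  have "\<bar>measure_pmf.expectation M f\<bar> \<le> measure_pmf.expectation M (\<lambda>x. \<bar>f x\<bar>)"
    by (rule integral_abs_bound)
  also have "\<dots> \<le> B"
    by (rule measure_pmf.integral_le_const)
      (use assms in \<open>auto simp: AE_measure_pmf_iff intro!: integrable_pmf_bounded[where B=B]\<close>)
  finally show ?thesis .
qed

text \<open>
  Boundedness supplies integrability over the mixture, whose support may be infinite because the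
  number of clauses is Poisson.
\<close>

lemma expectation_bind_bounded:
  fixes h :: "'b \<Rightarrow> real"
  assumes "\<And>x. \<bar>h x\<bar> \<le> B"
  shows "measure_pmf.expectation (bind_pmf M f) h
           = measure_pmf.expectation M (\<lambda>x. measure_pmf.expectation (f x) h)"
  unfolding measure_pmf_bind
  by (rule integral_bind[where K = "count_space UNIV" and B = B and B' = 1])
    (use assms in \<open>auto simp: emeasure_pmf measure_pmf_in_subprob_algebra measure_subprob\<close>)

lemma expectation_pair_prod:
  fixes f :: "'a \<Rightarrow> real" and g :: "'b \<Rightarrow> real"
  assumes "\<And>x. \<bar>f x\<bar> \<le> B" "\<And>x. \<bar>g x\<bar> \<le> C"
  shows "measure_pmf.expectation (pair_pmf M N) (\<lambda>(x, y). f x * g y)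
           = measure_pmf.expectation M f * measure_pmf.expectation N g"
proof -
  have "\<bar>f x * g y\<bar> \<le> B * C" for x y
    unfolding abs_mult using assms order_trans[OF abs_ge_zero assms(1)] by (intro mult_mono) auto
  hence B: "\<bar>case z of (x, y) \<Rightarrow> f x * g y\<bar> \<le> B * C" for z by (cases z) simp
  have "pair_pmf M N = bind_pmf M (\<lambda>x. map_pmf (Pair x) N)"
    by (simp add: pair_pmf_def map_pmf_def)
  thus ?thesis by (simp add: expectation_bind_bounded[OF B])
qed

lemma expectation_square_le:
  fixes f :: "'a \<Rightarrow> real"
  assumes "\<And>x. x \<in> set_pmf M \<Longrightarrow> \<bar>f x\<bar> \<le> B"
  shows "(measure_pmf.expectation M f)\<^sup>2 \<le> measure_pmf.expectation M (\<lambda>x. (f x)\<^sup>2)"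
proof -
  have i1: "integrable (measure_pmf M) f" by (rule integrable_pmf_bounded[OF assms])
  have i2: "integrable (measure_pmf M) (\<lambda>x. (f x)\<^sup>2)"
    by (rule integrable_pmf_bounded[where B="B\<^sup>2"])
       (metis assms abs_ge_zero abs_of_nonneg power2_abs power_mono zero_le_power2)
  have "0 \<le> measure_pmf.variance M f" by simp
  thus ?thesis using measure_pmf.variance_eq[OF i1 i2] by simp
qed

text \<open>
  For uniformly bounded variables, convergence in probability and in \<open>L\<^sup>2\<close> agree: one direction
  truncates at a small deviation, the other is Markov's inequality for the squared deviation.
\<close>

lemma tendsto_in_prob_iff_second_moment:
  assumes B: "\<And>n x. \<bar>X n x\<bar> \<le> B"
  shows "tendsto_in_prob M X c \<longleftrightarrow>
           (\<lambda>n. measure_pmf.expectation (M n) (\<lambda>x. (X n x - c)\<^sup>2)) \<longlonglongrightarrow> 0"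
proof
  define K where "K = (B + \<bar>c\<bar>)\<^sup>2 + 1"
  have K: "(X n x - c)\<^sup>2 \<le> K" for n x
  proof -
    have "\<bar>X n x - c\<bar> \<le> B + \<bar>c\<bar>" using B[of n x] by linarith
    hence "\<bar>X n x - c\<bar>\<^sup>2 \<le> (B + \<bar>c\<bar>)\<^sup>2" by (rule power_mono) simp
    thus ?thesis by (simp add: K_def)
  qed
  have K1: "K > 0" unfolding K_def by (simp add: add_nonneg_pos)
  have int: "integrable (measure_pmf (M n)) (\<lambda>x. (X n x - c)\<^sup>2)" for n
    by (rule integrable_pmf_bounded[where B=K]) (use K in simp)
  {
    assume L: "tendsto_in_prob M X c"
    have "eventually (\<lambda>n. \<bar>measure_pmf.expectation (M n) (\<lambda>x. (X n x - c)\<^sup>2)\<bar> < e) sequentially"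
      if e: "e > 0" for e
    proof -
      \<comment> \<open>Deviations up to this \<open>\<epsilon>\<close> cost at most \<open>e / 2\<close>; the rest costs \<open>K\<close> times a small probability.\<close>
      define \<epsilon> where "\<epsilon> = sqrt (e / 2)"
      have \<epsilon>: "\<epsilon> > 0" "\<epsilon>\<^sup>2 = e / 2" using e by (auto simp: \<epsilon>_def)
      have "(\<lambda>n. measure_pmf.prob (M n) {x. \<bar>X n x - c\<bar> > \<epsilon>}) \<longlonglongrightarrow> 0"
        using L \<epsilon> by (simp add: tendsto_in_prob_def)
      hence "eventually (\<lambda>n. measure_pmf.prob (M n) {x. \<bar>X n x - c\<bar> > \<epsilon>} < e / (2 * K)) sequentially"
        by (rule order_tendstoD) (use e K1 in simp)
      thus ?thesis
      proof eventually_elim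
        case (elim n)
        let ?P = "{x. \<bar>X n x - c\<bar> > \<epsilon>}"
        have "measure_pmf.expectation (M n) (\<lambda>x. (X n x - c)\<^sup>2)
                \<le> measure_pmf.expectation (M n) (\<lambda>x. e / 2 + K * indicator ?P x)"
        proof (rule integral_mono[OF int])
          show "integrable (measure_pmf (M n)) (\<lambda>x. e / 2 + K * indicator ?P x)"
            by (rule integrable_pmf_bounded[where B="e / 2 + K"]) (use e K1 in \<open>auto simp: indicator_def\<close>)
          fix x
          show "(X n x - c)\<^sup>2 \<le> e / 2 + K * indicator ?P x"
          proof (cases "x \<in> ?P")
            case False
            hence "(X n x - c)\<^sup>2 \<le> \<epsilon>\<^sup>2" by (intro abs_le_square_iff[THEN iffD1]) (use \<epsilon> in auto)
            thus ?thesis using False \<epsilon> by simp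
          qed (use K[of n x] e in simp)
        qed
        also have "\<dots> = e / 2 + K * measure_pmf.prob (M n) ?P"
          by (subst Bochner_Integration.integral_add) (auto intro!: integrable_pmf_bounded[where B=1] split: split_indicator)
        also have "\<dots> < e" using elim K1 by (simp add: field_simps)
        finally show ?case by (simp add: abs_of_nonneg)
      qed
    qed
    thus "(\<lambda>n. measure_pmf.expectation (M n) (\<lambda>x. (X n x - c)\<^sup>2)) \<longlonglongrightarrow> 0"
      by (intro tendstoI) (simp add: dist_real_def)
  }
  {
    assume R: "(\<lambda>n. measure_pmf.expectation (M n) (\<lambda>x. (X n x - c)\<^sup>2)) \<longlonglongrightarrow> 0"
    show "tendsto_in_prob M X c" unfolding tendsto_in_prob_def
    proof (intro allI impI)
      fix \<epsilon> :: real assume \<epsilon>: "\<epsilon> > 0"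
      show "(\<lambda>n. measure_pmf.prob (M n) {x. \<bar>X n x - c\<bar> > \<epsilon>}) \<longlonglongrightarrow> 0"
      proof (rule tendsto_sandwich[OF _ _ tendsto_const])
        show "\<forall>\<^sub>F n in sequentially. measure_pmf.prob (M n) {x. \<bar>X n x - c\<bar> > \<epsilon>}
           \<le> measure_pmf.expectation (M n) (\<lambda>x. (X n x - c)\<^sup>2) / \<epsilon>\<^sup>2"
        proof (intro always_eventually allI)
          fix n
          have "measure_pmf.prob (M n) {x. \<bar>X n x - c\<bar> > \<epsilon>} \<le> measure_pmf.prob (M n) {x. (X n x - c)\<^sup>2 \<ge> \<epsilon>\<^sup>2}"
            by (rule measure_pmf.finite_measure_mono) (use \<epsilon> in \<open>auto simp: abs_le_square_iff[symmetric]\<close>)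
          also have "\<dots> \<le> measure_pmf.expectation (M n) (\<lambda>x. (X n x - c)\<^sup>2) / \<epsilon>\<^sup>2"
            using integral_Markov_inequality_measure[OF int, of "{}" n "\<epsilon>\<^sup>2"] \<epsilon> by simp
          finally show "measure_pmf.prob (M n) {x. \<bar>X n x - c\<bar> > \<epsilon>}
             \<le> measure_pmf.expectation (M n) (\<lambda>x. (X n x - c)\<^sup>2) / \<epsilon>\<^sup>2" .
        qed
        show "(\<lambda>n. measure_pmf.expectation (M n) (\<lambda>x. (X n x - c)\<^sup>2) / \<epsilon>\<^sup>2) \<longlonglongrightarrow> 0"
          using tendsto_divide[OF R tendsto_const[of "\<epsilon>\<^sup>2"]] \<epsilon> by simp
      qed simp
    qed
  }
qed

text \<open>
  A function attains a value at least as large as its mean; this turns a randomized strategy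
  into a deterministic one.
\<close>

lemma exists_ge_expectation:
  fixes f :: "'a \<Rightarrow> real"
  assumes "\<And>x. \<bar>f x\<bar> \<le> B"
  shows "\<exists>x\<in>set_pmf M. measure_pmf.expectation M f \<le> f x"
proof (rule ccontr)
  assume "\<not> ?thesis"
  hence lt: "f x < measure_pmf.expectation M f" if "x \<in> set_pmf M" for x using that by force
  have int: "integrable (measure_pmf M) f" by (rule integrable_pmf_bounded) (rule assms)
  have "measure_pmf.expectation M f < measure_pmf.expectation M (\<lambda>_. measure_pmf.expectation M f)"
    by (rule measure_pmf.integral_less_AE_space[OF int]) (use lt in \<open>auto simp: AE_measure_pmf_iff measure_pmf.emeasure_space_1\<close>)
  thus False by simp
qed

lemma prob_eq_expectation_of_bool:
  "measure_pmf.prob M {x. P x} = measure_pmf.expectation M (\<lambda>x. of_bool (P x))"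
proof -
  have "(\<lambda>x. of_bool (P x)) = indicat_real {x. P x}" by (auto simp: fun_eq_iff)
  thus ?thesis by simp
qed

text \<open>
  If no summand deviates by more than \<open>\<epsilon> / W\<close>, the weighted sum deviates by at most \<open>\<epsilon>\<close>, so a
  union bound suffices.
\<close>

lemma tendsto_in_prob_weighted_sum:
  assumes "finite I" and lim: "\<And>i. i \<in> I \<Longrightarrow> tendsto_in_prob M (X i) (c i)"
  shows "tendsto_in_prob M (\<lambda>n x. \<Sum>i\<in>I. w i * X i n x) (\<Sum>i\<in>I. w i * c i)"
  unfolding tendsto_in_prob_def
proof (intro allI impI)
  fix \<epsilon> :: real assume \<epsilon>: "\<epsilon> > 0"
  define W where "W = (\<Sum>i\<in>I. \<bar>w i\<bar>) + 1"
  have W: "W > 0" unfolding W_def by (rule add_nonneg_pos) (auto intro: sum_nonneg)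
  have sub: "{x. \<bar>(\<Sum>i\<in>I. w i * X i n x) - (\<Sum>i\<in>I. w i * c i)\<bar> > \<epsilon>} \<subseteq> (\<Union>i\<in>I. {x. \<bar>X i n x - c i\<bar> > \<epsilon> / W})" for n
  proof (rule subsetI, rule ccontr)
    fix x assume x: "x \<in> {x. \<bar>(\<Sum>i\<in>I. w i * X i n x) - (\<Sum>i\<in>I. w i * c i)\<bar> > \<epsilon>}"
      and "x \<notin> (\<Union>i\<in>I. {x. \<bar>X i n x - c i\<bar> > \<epsilon> / W})"
    hence le: "\<bar>X i n x - c i\<bar> \<le> \<epsilon> / W" if "i \<in> I" for i using that by auto
    have "\<bar>(\<Sum>i\<in>I. w i * X i n x) - (\<Sum>i\<in>I. w i * c i)\<bar> = \<bar>\<Sum>i\<in>I. w i * (X i n x - c i)\<bar>"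
      by (simp add: sum_subtractf right_diff_distrib)
    also have "\<dots> \<le> (\<Sum>i\<in>I. \<bar>w i\<bar> * (\<epsilon> / W))"
      by (rule order_trans[OF sum_abs], rule sum_mono)
         (simp only: abs_mult, intro mult_left_mono le abs_ge_zero)
    also have "\<dots> = (W - 1) * (\<epsilon> / W)" unfolding W_def by (simp only: sum_distrib_right add_diff_cancel_right')
    also have "\<dots> \<le> \<epsilon>" using W \<epsilon> by (simp add: field_simps)
    finally show False using x by simp
  qed
  show "(\<lambda>n. measure_pmf.prob (M n) {x. \<bar>(\<Sum>i\<in>I. w i * X i n x) - (\<Sum>i\<in>I. w i * c i)\<bar> > \<epsilon>}) \<longlonglongrightarrow> 0"
  proof (rule tendsto_sandwich[OF _ _ tendsto_const])
    show "\<forall>\<^sub>F n in sequentially. measure_pmf.prob (M n) {x. \<bar>(\<Sum>i\<in>I. w i * X i n x) - (\<Sum>i\<in>I. w i * c i)\<bar> > \<epsilon>}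
        \<le> (\<Sum>i\<in>I. measure_pmf.prob (M n) {x. \<bar>X i n x - c i\<bar> > \<epsilon> / W})"
    proof (intro always_eventually allI)
      fix n
      show "measure_pmf.prob (M n) {x. \<bar>(\<Sum>i\<in>I. w i * X i n x) - (\<Sum>i\<in>I. w i * c i)\<bar> > \<epsilon>}
        \<le> (\<Sum>i\<in>I. measure_pmf.prob (M n) {x. \<bar>X i n x - c i\<bar> > \<epsilon> / W})"
        by (rule order_trans[OF measure_pmf.finite_measure_mono[OF sub]
              measure_pmf.finite_measure_subadditive_finite]) (use assms in auto)
    qed
    have "(\<lambda>n. \<Sum>i\<in>I. measure_pmf.prob (M n) {x. \<bar>X i n x - c i\<bar> > \<epsilon> / W}) \<longlonglongrightarrow> (\<Sum>i\<in>I. 0)"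
      by (rule tendsto_sum) (use lim \<epsilon> W in \<open>auto simp: tendsto_in_prob_def\<close>)
    thus "(\<lambda>n. \<Sum>i\<in>I. measure_pmf.prob (M n) {x. \<bar>X i n x - c i\<bar> > \<epsilon> / W}) \<longlonglongrightarrow> 0" by simp
  qed simp
qed

lemma map_two_components_Pi_pmf:
  assumes "finite A" "u \<in> A" "v \<in> A" "u \<noteq> v"
  shows "map_pmf (\<lambda>x. (x u, x v)) (Pi_pmf A dflt p) = pair_pmf (p u) (p v)"
proof (rule pmf_eqI)
  fix z :: "'b \<times> 'b"
  obtain i j where z: "z = (i, j)" by (cases z)
  define B where "B = (\<lambda>w. if w = u then {i} else if w = v then {j} else UNIV)"
  have "pmf (map_pmf (\<lambda>x. (x u, x v)) (Pi_pmf A dflt p)) z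
      = measure_pmf.prob (Pi_pmf A dflt p) (Pi A B)"
    unfolding pmf_map by (rule arg_cong[where f = "measure_pmf.prob _"])
      (use assms in \<open>auto simp: B_def z Pi_def split: if_splits\<close>)
  also have "\<dots> = (\<Prod>w\<in>A. measure_pmf.prob (p w) (B w))" by (rule measure_Pi_pmf_Pi[OF assms(1)])
  also have "\<dots> = (\<Prod>w\<in>{u, v}. measure_pmf.prob (p w) (B w))"
    by (rule prod.mono_neutral_right) (use assms in \<open>auto simp: B_def measure_pmf.prob_space[simplified]\<close>)
  also have "\<dots> = pmf (pair_pmf (p u) (p v)) z"
    using assms(4) by (simp add: B_def z pmf_pair measure_pmf_single)
  finally show "pmf (map_pmf (\<lambda>x. (x u, x v)) (Pi_pmf A dflt p)) z = pmf (pair_pmf (p u) (p v)) z" .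
qed

section \<open>Posteriors and replicas\<close>

definition posterior_of :: "('s \<times> 'g) pmf \<Rightarrow> 'g \<Rightarrow> 's pmf" where
  "posterior_of J G = map_pmf fst (cond_pmf J {x. snd x = G})"

text \<open>
  The law of two posterior samples sharing one observation \<open>G\<close>, with \<open>G\<close> averaged out. All
  statements about posteriors are transported to this law, whose support is finite for labellings.
\<close>

definition replicas :: "('s \<times> 'g) pmf \<Rightarrow> ('s \<times> 's) pmf" where
  "replicas J = bind_pmf (map_pmf snd J) (\<lambda>G. pair_pmf (posterior_of J G) (posterior_of J G))"

lemma cond_pmf_snd_eq:
  assumes "G \<in> set_pmf (map_pmf snd J)"
  shows "cond_pmf J {x. snd x = G} = map_pmf (\<lambda>s. (s, G)) (posterior_of J G)"
proof -
  have ne: "set_pmf J \<inter> {x. snd x = G} \<noteq> {}" using assms by auto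
  have "map_pmf (\<lambda>s. (s, G)) (posterior_of J G) = map_pmf (\<lambda>x. (fst x, G)) (cond_pmf J {x. snd x = G})"
    by (simp add: posterior_of_def pmf.map_comp o_def)
  also have "\<dots> = map_pmf (\<lambda>x. x) (cond_pmf J {x. snd x = G})"
    by (rule map_pmf_cong) (use ne in auto)
  finally show ?thesis by simp
qed

text \<open>
  Resampling the hidden variable from its posterior given the observation does not change the
  joint law.
\<close>

lemma bind_posterior_of:
  "bind_pmf (map_pmf snd J) (\<lambda>G. map_pmf (\<lambda>s. (s, G)) (posterior_of J G)) = J"
proof -
  have "bind_pmf (map_pmf snd J) (\<lambda>G. map_pmf (\<lambda>s. (s, G)) (posterior_of J G))
          = bind_pmf (map_pmf snd J) (\<lambda>G. cond_pmf J {x. snd x = G})"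
    by (rule bind_pmf_cong) (auto simp: cond_pmf_snd_eq)
  also have "\<dots> = bind_pmf (map_pmf snd J) (\<lambda>G. cond_pmf J {x. G = snd x})"
    by (simp add: eq_commute)
  also have "\<dots> = J"
  proof (rule bind_cond_pmf_cancel)
    fix G y assume "G = snd (y :: 'a \<times> 'b)"
    thus "measure_pmf.prob J {y. G = snd y} = measure_pmf.prob (map_pmf snd J) {x. x = snd y}"
      by (simp add: vimage_def eq_commute)
  qed auto
  finally show ?thesis .
qed

lemma expectation_posterior:
  assumes "\<And>s G. \<bar>h s G\<bar> \<le> (B :: real)"
  shows "measure_pmf.expectation (map_pmf snd J) (\<lambda>G. measure_pmf.expectation (posterior_of J G) (\<lambda>s. h s G))
           = measure_pmf.expectation J (\<lambda>(s, G). h s G)"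
proof -
  have "measure_pmf.expectation J (\<lambda>(s, G). h s G) = measure_pmf.expectation
     (bind_pmf (map_pmf snd J) (\<lambda>G. map_pmf (\<lambda>s. (s, G)) (posterior_of J G))) (\<lambda>(s, G). h s G)"
    by (simp only: bind_posterior_of)
  also have "\<dots> = measure_pmf.expectation (map_pmf snd J)
      (\<lambda>G. measure_pmf.expectation (posterior_of J G) (\<lambda>s. h s G))"
    by (subst expectation_bind_bounded[where B=B]) (use assms in auto)
  finally show ?thesis ..
qed

lemma expectation_replicas:
  assumes "\<And>z. \<bar>h z\<bar> \<le> (B :: real)"
  shows "measure_pmf.expectation (replicas J) h = measure_pmf.expectation (map_pmf snd J)
           (\<lambda>G. measure_pmf.expectation (pair_pmf (posterior_of J G) (posterior_of J G)) h)"
  unfolding replicas_def by (rule expectation_bind_bounded[OF assms])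

lemma map_fst_replicas: "map_pmf fst (replicas J) = map_pmf fst J"
proof -
  have "map_pmf fst J = map_pmf fst (bind_pmf (map_pmf snd J) (\<lambda>G. map_pmf (\<lambda>s. (s, G)) (posterior_of J G)))"
    by (simp only: bind_posterior_of)
  thus ?thesis
    by (simp add: replicas_def map_bind_pmf map_fst_pair_pmf pmf.map_comp o_def)
qed

lemma map_snd_replicas: "map_pmf snd (replicas J) = map_pmf fst J"
proof -
  have "map_pmf fst J = map_pmf fst (bind_pmf (map_pmf snd J) (\<lambda>G. map_pmf (\<lambda>s. (s, G)) (posterior_of J G)))"
    by (simp only: bind_posterior_of)
  thus ?thesis
    by (simp add: replicas_def map_bind_pmf map_snd_pair_pmf pmf.map_comp o_def)
qed

lemma expectation_replicas_fst:
  fixes h :: "'s \<Rightarrow> real"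
  shows "measure_pmf.expectation (replicas J) (\<lambda>(x, y). h x) = measure_pmf.expectation (map_pmf fst J) h"
  using integral_map_pmf[of "fst" "replicas J" h] by (simp only: map_fst_replicas case_prod_unfold)

lemma expectation_replicas_snd:
  fixes h :: "'s \<Rightarrow> real"
  shows "measure_pmf.expectation (replicas J) (\<lambda>(x, y). h y) = measure_pmf.expectation (map_pmf fst J) h"
  using integral_map_pmf[of "snd" "replicas J" h] by (simp only: map_snd_replicas case_prod_unfold)

text \<open>
  The square of a posterior mean is the posterior mean of a product over two independent samples.
\<close>

lemma expectation_posterior_square:
  assumes B: "\<And>s. \<bar>h s\<bar> \<le> (B :: real)"
  shows "measure_pmf.expectation (map_pmf snd J) (\<lambda>G. (measure_pmf.expectation (posterior_of J G) h)\<^sup>2)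
           = measure_pmf.expectation (replicas J) (\<lambda>(x, y). h x * h y)"
proof -
  have "\<bar>h x * h y\<bar> \<le> B * B" for x y
    unfolding abs_mult using B order_trans[OF abs_ge_zero B] by (intro mult_mono) auto
  hence BB: "\<bar>case z of (x, y) \<Rightarrow> h x * h y\<bar> \<le> B * B" for z by (cases z) simp
  show ?thesis
    by (subst expectation_replicas[OF BB]) (simp add: expectation_pair_prod[OF B B] power2_eq_square)
qed

text \<open>
  When the overall mean is \<open>c\<close>, the second moment of the posterior mean around \<open>c\<close> is the replica
  correlation minus \<open>c\<^sup>2\<close>, so convergence in probability becomes a limit of replica expectations.
\<close>

lemma posterior_in_prob_iff:
  fixes h :: "nat \<Rightarrow> 's \<Rightarrow> real"
  assumes B: "\<And>n s. \<bar>h n s\<bar> \<le> B"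
    and mean: "eventually (\<lambda>n. measure_pmf.expectation (map_pmf fst (J n)) (h n) = c) sequentially"
  shows "tendsto_in_prob (\<lambda>n. map_pmf snd (J n)) (\<lambda>n G. measure_pmf.expectation (posterior_of (J n) G) (h n)) c
     \<longleftrightarrow> (\<lambda>n. measure_pmf.expectation (replicas (J n)) (\<lambda>(x, y). h n x * h n y)) \<longlonglongrightarrow> c\<^sup>2"
proof -
  let ?m = "\<lambda>n G. measure_pmf.expectation (posterior_of (J n) G) (h n)"
  let ?R = "\<lambda>n. measure_pmf.expectation (replicas (J n)) (\<lambda>(x, y). h n x * h n y)"
  have mB: "\<bar>?m n G\<bar> \<le> B" for n G by (rule abs_expectation_le) (rule B)
  have B0: "B \<ge> 0" using order_trans[OF abs_ge_zero B] .
  have mB2: "\<bar>(?m n G)\<^sup>2\<bar> \<le> B\<^sup>2" for n G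
    using power_mono[OF mB[of n G] abs_ge_zero, of 2] by simp
  have i1: "integrable (measure_pmf (map_pmf snd (J n))) (?m n)" for n
    by (rule integrable_pmf_bounded[OF mB])
  have i2: "integrable (measure_pmf (map_pmf snd (J n))) (\<lambda>G. (?m n G)\<^sup>2)" for n
    by (rule integrable_pmf_bounded[OF mB2])
  have mm: "measure_pmf.expectation (map_pmf snd (J n)) (?m n) = measure_pmf.expectation (map_pmf fst (J n)) (h n)" for n
    using expectation_posterior[of "\<lambda>s G. h n s" B "J n"] B by (simp add: case_prod_unfold)
  have expand: "measure_pmf.expectation (map_pmf snd (J n)) (\<lambda>G. (?m n G - c)\<^sup>2)
      = ?R n - 2 * c * measure_pmf.expectation (map_pmf fst (J n)) (h n) + c\<^sup>2" for n
  proof -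
    have "(\<lambda>G. (?m n G - c)\<^sup>2) = (\<lambda>G. (?m n G)\<^sup>2 - 2 * c * ?m n G + c\<^sup>2)"
      by (simp add: power2_diff fun_eq_iff)
    hence "measure_pmf.expectation (map_pmf snd (J n)) (\<lambda>G. (?m n G - c)\<^sup>2)
        = measure_pmf.expectation (map_pmf snd (J n)) (\<lambda>G. (?m n G)\<^sup>2 - 2 * c * ?m n G + c\<^sup>2)"
      by (simp only:)
    also have "\<dots> = measure_pmf.expectation (map_pmf snd (J n)) (\<lambda>G. (?m n G)\<^sup>2)
       - 2 * c * measure_pmf.expectation (map_pmf snd (J n)) (?m n) + c\<^sup>2"
      using i1 i2 by (simp del: integral_map_pmf)
    finally show ?thesis unfolding mm expectation_posterior_square[OF B] .
  qed
  have "eventually (\<lambda>n. measure_pmf.expectation (map_pmf snd (J n)) (\<lambda>G. (?m n G - c)\<^sup>2) = ?R n - c\<^sup>2) sequentially"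
    using mean by eventually_elim (simp only: expand, simp add: power2_eq_square)
  hence "(\<lambda>n. measure_pmf.expectation (map_pmf snd (J n)) (\<lambda>G. (?m n G - c)\<^sup>2)) \<longlonglongrightarrow> 0
     \<longleftrightarrow> (\<lambda>n. ?R n - c\<^sup>2) \<longlonglongrightarrow> 0" by (rule tendsto_cong)
  also have "\<dots> \<longleftrightarrow> ?R \<longlonglongrightarrow> c\<^sup>2" using Lim_null[of ?R "c\<^sup>2" sequentially] by simp
  finally show ?thesis
    using tendsto_in_prob_iff_second_moment[of ?m B "\<lambda>n. map_pmf snd (J n)" c] mB by blast
qed

text \<open>
  A symmetry of the joint law carries the posterior at \<open>G\<close> to the posterior at \<open>T G\<close>; injectivity
  of \<open>T\<close> is what makes the two conditioning events correspond. Averaging over \<open>G\<close> then removes \<open>T\<close>.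
\<close>

lemma replicas_invariant:
  assumes inj: "inj T" and inv: "map_pmf (\<lambda>(s, G). (f s, T G)) J = J"
  shows "map_pmf (\<lambda>(x, y). (f x, f y)) (replicas J) = replicas J"
proof -
  let ?h = "\<lambda>(s, G). (f s, T G)"
  have eq: "posterior_of J (T G) = map_pmf f (posterior_of J G)" if G: "G \<in> set_pmf (map_pmf snd J)" for G
  proof -
    have v: "?h -` {x. snd x = T G} = {x. snd x = G}" using inj by (auto simp: inj_eq)
    have ne: "set_pmf J \<inter> ?h -` {x. snd x = T G} \<noteq> {}" unfolding v using G by auto
    have "posterior_of J (T G) = map_pmf fst (cond_pmf (map_pmf ?h J) {x. snd x = T G})"
      by (simp add: posterior_of_def inv)
    also have "\<dots> = map_pmf (fst \<circ> ?h) (cond_pmf J {x. snd x = G})"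
      by (simp only: cond_map_pmf[OF ne] v pmf.map_comp)
    also have "fst \<circ> ?h = f \<circ> fst" by auto
    finally show ?thesis by (simp only: posterior_of_def pmf.map_comp)
  qed
  have "map_pmf snd J = map_pmf snd (map_pmf ?h J)" by (simp add: inv)
  also have "\<dots> = map_pmf T (map_pmf snd J)" by (simp add: pmf.map_comp o_def case_prod_unfold)
  finally have sT: "map_pmf snd J = map_pmf T (map_pmf snd J)" .
  have "replicas J = bind_pmf (map_pmf T (map_pmf snd J)) (\<lambda>G. pair_pmf (posterior_of J G) (posterior_of J G))"
    unfolding replicas_def by (subst (1) sT) (rule refl)
  also have "\<dots> = bind_pmf (map_pmf snd J) (\<lambda>G. pair_pmf (posterior_of J (T G)) (posterior_of J (T G)))"
    by (simp only: bind_map_pmf)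
  also have "\<dots> = bind_pmf (map_pmf snd J) (\<lambda>G. map_pmf (\<lambda>(x, y). (f x, f y)) (pair_pmf (posterior_of J G) (posterior_of J G)))"
    by (rule bind_pmf_cong[OF refl]) (simp only: eq map_pair)
  also have "\<dots> = map_pmf (\<lambda>(x, y). (f x, f y)) (replicas J)"
    by (simp only: replicas_def map_bind_pmf)
  finally show ?thesis by (rule sym)
qed

section \<open>The overlap as the best alignment of a matrix\<close>

text \<open>
  The sum does not depend on \<open>i\<close>, as composing with a transposition shows, and summed over all \<open>i\<close>
  each permutation contributes the full sum of \<open>f\<close>.
\<close>

lemma sum_over_permutations:
  fixes f :: "'q::finite \<Rightarrow> real"
  shows "(\<Sum>\<Gamma> | \<Gamma> permutes UNIV. f (\<Gamma> i)) = fact CARD('q) / CARD('q) * (\<Sum>j\<in>UNIV. f j)"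
proof -
  let ?S = "{\<Gamma> :: 'q \<Rightarrow> 'q. \<Gamma> permutes UNIV}"
  have eq: "(\<Sum>\<Gamma>\<in>?S. f (\<Gamma> i)) = (\<Sum>\<Gamma>\<in>?S. f (\<Gamma> i'))" for i'
  proof -
    let ?t = "Transposition.transpose i i'"
    have t: "?t permutes UNIV" by (rule permutes_swap_id) auto
    have tt: "\<Gamma> \<circ> ?t \<circ> ?t = \<Gamma>" for \<Gamma> :: "'q \<Rightarrow> 'q" by (simp add: fun_eq_iff)
    show ?thesis
      by (rule sum.reindex_bij_witness[of _ "\<lambda>\<Gamma>. \<Gamma> \<circ> ?t" "\<lambda>\<Gamma>. \<Gamma> \<circ> ?t"])
         (simp_all add: tt permutes_compose[OF t])
  qed
  have "CARD('q) * (\<Sum>\<Gamma>\<in>?S. f (\<Gamma> i)) = (\<Sum>i'\<in>(UNIV :: 'q set). \<Sum>\<Gamma>\<in>?S. f (\<Gamma> i))"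
    by simp
  also have "\<dots> = (\<Sum>i'\<in>UNIV. \<Sum>\<Gamma>\<in>?S. f (\<Gamma> i'))"
    by (rule sum.cong[OF refl eq])
  also have "\<dots> = (\<Sum>\<Gamma>\<in>?S. \<Sum>i'\<in>UNIV. f (\<Gamma> i'))"
    by (rule sum.swap)
  also have "\<dots> = (\<Sum>\<Gamma>\<in>?S. \<Sum>j\<in>UNIV. f j)"
    by (intro sum.cong refl sum.reindex_bij_betw) (simp add: permutes_imp_bij)
  also have "\<dots> = fact CARD('q) * (\<Sum>j\<in>UNIV. f j)"
    by (simp add: card_permutations[OF refl])
  finally show ?thesis by (simp add: field_simps)
qed

lemma exists_permutation_two_points:
  assumes "i \<noteq> i'" "j \<noteq> j'" "i \<in> S" "i' \<in> S" "j \<in> S" "j' \<in> S"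
  shows "\<exists>\<Gamma>. \<Gamma> permutes S \<and> \<Gamma> i = j \<and> \<Gamma> i' = j'"
proof (intro exI conjI)
  let ?\<Gamma> = "Transposition.transpose (Transposition.transpose i j i') j' \<circ> Transposition.transpose i j"
  show "?\<Gamma> permutes S"
    by (intro permutes_compose permutes_swap_id) (use assms in \<open>auto simp: Transposition.transpose_def\<close>)
  show "?\<Gamma> i = j" "?\<Gamma> i' = j'" using assms by (auto simp: Transposition.transpose_def)
qed

text \<open>
  The score of a single permutation in the overlap, as a function of the joint frequency matrix of
  two labellings. A vanishing row contributes \<open>0\<close> through division by zero.
\<close>

definition alignment :: "('q::finite \<Rightarrow> 'q \<Rightarrow> real) \<Rightarrow> ('q \<Rightarrow> 'q) \<Rightarrow> real" where
  "alignment R \<Gamma> = 1 / real CARD('q) * (\<Sum>i\<in>UNIV. R i (\<Gamma> i) / (\<Sum>j\<in>UNIV. R i j))"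

definition max_alignment :: "('q::finite \<Rightarrow> 'q \<Rightarrow> real) \<Rightarrow> real" where
  "max_alignment R = (MAX \<Gamma>\<in>{\<Gamma>. \<Gamma> permutes UNIV}. alignment R \<Gamma>)"

lemma alignment_le_max: "\<Gamma> permutes UNIV \<Longrightarrow> alignment R \<Gamma> \<le> max_alignment R"
  unfolding max_alignment_def by (rule Max_ge) (auto simp: finite_permutations)

lemma max_alignment_attained: "\<exists>\<Gamma>. \<Gamma> permutes UNIV \<and> max_alignment R = alignment R \<Gamma>"
proof -
  have "max_alignment R \<in> alignment R ` {\<Gamma>. \<Gamma> permutes UNIV}"
    unfolding max_alignment_def
    by (rule Max_in) (auto simp: finite_permutations intro!: exI[of _ id] permutes_id)
  thus ?thesis by auto
qed

text \<open>
  This replaces the empirical row sum \<open>\<rho>\<close> in a denominator by its limit \<open>a\<close>, and it survives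
  \<open>\<rho> = 0\<close> because then \<open>r = 0\<close>.
\<close>

lemma abs_ratio_diff_le:
  fixes r \<rho> a :: real
  assumes "0 \<le> r" "r \<le> \<rho>" "a > 0"
  shows "\<bar>r / \<rho> - r / a\<bar> \<le> \<bar>\<rho> - a\<bar> / a"
proof (cases "\<rho> = 0")
  case False
  hence \<rho>: "\<rho> > 0" using assms by simp
  have "r / \<rho> - r / a = (r / \<rho>) * ((a - \<rho>) / a)" using \<rho> assms by (simp add: field_simps)
  hence "\<bar>r / \<rho> - r / a\<bar> = (r / \<rho>) * (\<bar>\<rho> - a\<bar> / a)"
    using assms \<rho> by (simp add: abs_mult abs_minus_commute)
  also have "\<dots> \<le> 1 * (\<bar>\<rho> - a\<bar> / a)"
    by (rule mult_right_mono) (use assms \<rho> in auto)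
  finally show ?thesis by simp
qed (use assms in auto)

lemma entry_le_row_sum:
  fixes R :: "'q::finite \<Rightarrow> 'q \<Rightarrow> real"
  assumes "\<And>i j. R i j \<ge> 0"
  shows "R i j \<le> (\<Sum>j\<in>UNIV. R i j)"
  by (rule member_le_sum) (use assms in auto)

lemma max_alignment_bounds:
  fixes R :: "'q::finite \<Rightarrow> 'q \<Rightarrow> real"
  assumes nn: "\<And>i j. R i j \<ge> 0"
  shows "0 \<le> max_alignment R" "max_alignment R \<le> 1"
proof -
  obtain \<Gamma> where "\<Gamma> permutes UNIV" and \<Gamma>: "max_alignment R = alignment R \<Gamma>"
    using max_alignment_attained by blast
  show "0 \<le> max_alignment R"
    unfolding \<Gamma> alignment_def using nn by (intro mult_nonneg_nonneg sum_nonneg divide_nonneg_nonneg) auto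
  have "(\<Sum>i\<in>UNIV. R i (\<Gamma> i) / (\<Sum>j\<in>UNIV. R i j)) \<le> (\<Sum>i\<in>(UNIV::'q set). 1)"
  proof (rule sum_mono)
    fix i
    show "R i (\<Gamma> i) / (\<Sum>j\<in>UNIV. R i j) \<le> 1"
      using entry_le_row_sum[of R i "\<Gamma> i", OF nn] nn[of i "\<Gamma> i"] by (auto simp: divide_le_eq_1)
  qed
  thus "max_alignment R \<le> 1" unfolding \<Gamma> alignment_def by (simp add: field_simps)
qed

text \<open>
  If \<open>R\<^sub>i\<^sub>j\<close> is close to \<open>a\<^sub>i \<tau>\<^sub>j\<close>, the normalised rows are all close to \<open>\<tau>\<close>, and any permutation
  picks entries of total weight close to \<open>\<Sum>\<^sub>j \<tau>\<^sub>j = 1\<close>. The same deviations control the row sums,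
  because \<open>\<rho>\<^sub>i - a\<^sub>i\<close> is their sum over row \<open>i\<close>.
\<close>

lemma max_alignment_near_trivial:
  fixes R :: "'q::finite \<Rightarrow> 'q \<Rightarrow> real"
  assumes nn: "\<And>i j. R i j \<ge> 0" and total: "(\<Sum>i\<in>UNIV. \<Sum>j\<in>UNIV. R i j) = 1"
    and a: "\<And>i. a i \<ge> m" "m > 0"
  defines "\<tau> \<equiv> \<lambda>j. \<Sum>i\<in>UNIV. R i j"
  shows "\<bar>max_alignment R - 1 / CARD('q)\<bar> \<le> 2 / m * (\<Sum>i\<in>UNIV. \<Sum>j\<in>UNIV. \<bar>R i j - a i * \<tau> j\<bar>)"
proof -
  define \<rho> where "\<rho> i = (\<Sum>j\<in>UNIV. R i j)" for i
  define D where "D = (\<Sum>i\<in>UNIV. \<Sum>j\<in>UNIV. \<bar>R i j - a i * \<tau> j\<bar>)"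
  have apos: "a i > 0" for i using a(1)[of i] a(2) by linarith
  have \<tau>1: "(\<Sum>j\<in>UNIV. \<tau> j) = 1" unfolding \<tau>_def by (subst sum.swap) (rule total)
  have row: "(\<Sum>j\<in>UNIV. \<bar>R i j - a i * \<tau> j\<bar>) \<le> D" for i
    unfolding D_def by (rule member_le_sum) (auto intro: sum_nonneg)
  have entry: "\<bar>R i j - a i * \<tau> j\<bar> \<le> D" for i j
    by (rule order_trans[OF _ row[of i]], rule member_le_sum) auto
  have "\<rho> i - a i = (\<Sum>j\<in>UNIV. R i j - a i * \<tau> j)" for i
    by (simp add: \<rho>_def sum_subtractf \<tau>1 flip: sum_distrib_left)
  hence \<rho>D: "\<bar>\<rho> i - a i\<bar> \<le> D" for i
    using order_trans[OF sum_abs row[of i]] by (simp only:)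
  have D0: "D \<ge> 0" unfolding D_def by (intro sum_nonneg) auto
  have quotient: "\<bar>R i j / \<rho> i - \<tau> j\<bar> \<le> 2 * D / m" for i j
  proof -
    have "\<bar>R i j / \<rho> i - R i j / a i\<bar> \<le> \<bar>\<rho> i - a i\<bar> / a i"
      by (rule abs_ratio_diff_le) (use nn apos entry_le_row_sum[OF nn] in \<open>auto simp: \<rho>_def\<close>)
    also have "\<dots> \<le> D / m" by (rule frac_le) (use \<rho>D D0 a in auto)
    finally have 1: "\<bar>R i j / \<rho> i - R i j / a i\<bar> \<le> D / m" .
    have "R i j / a i - \<tau> j = (R i j - a i * \<tau> j) / a i" using apos[of i] by (simp add: field_simps)
    hence "\<bar>R i j / a i - \<tau> j\<bar> = \<bar>R i j - a i * \<tau> j\<bar> / a i" using apos[of i] by simp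
    also have "\<dots> \<le> D / m" by (rule frac_le) (use entry D0 a in auto)
    finally have 2: "\<bar>R i j / a i - \<tau> j\<bar> \<le> D / m" .
    show ?thesis using 1 2 by linarith
  qed
  obtain \<Gamma> where \<Gamma>: "\<Gamma> permutes UNIV" "max_alignment R = alignment R \<Gamma>"
    using max_alignment_attained by blast
  have "(\<Sum>i\<in>UNIV. \<tau> (\<Gamma> i)) = 1"
    using sum.reindex_bij_betw[of \<Gamma> UNIV UNIV \<tau>] \<Gamma>(1) \<tau>1 by (simp add: permutes_imp_bij)
  hence "max_alignment R - 1 / CARD('q) = 1 / CARD('q) * (\<Sum>i\<in>UNIV. R i (\<Gamma> i) / \<rho> i - \<tau> (\<Gamma> i))"
    unfolding \<Gamma>(2) alignment_def by (simp add: sum_subtractf \<rho>_def right_diff_distrib diff_divide_distrib)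
  hence "\<bar>max_alignment R - 1 / CARD('q)\<bar> \<le> 1 / CARD('q) * (\<Sum>i\<in>UNIV. \<bar>R i (\<Gamma> i) / \<rho> i - \<tau> (\<Gamma> i)\<bar>)"
    by (simp add: abs_mult divide_right_mono sum_abs)
  also have "\<dots> \<le> 1 / CARD('q) * (\<Sum>i\<in>(UNIV::'q set). 2 * D / m)"
    by (intro mult_left_mono sum_mono quotient) auto
  also have "\<dots> = 2 / m * D" by simp
  finally show ?thesis by (simp add: D_def)
qed

text \<open>
  The converse. Write \<open>N\<^sub>i\<^sub>j = R\<^sub>i\<^sub>j / a\<^sub>i\<close> and let \<open>B\<^sub>\<Gamma>\<close> be the resulting score of \<open>\<Gamma>\<close>. The average
  of \<open>B\<^sub>\<Gamma>\<close> is at least \<open>1/q - \<eta>\<close> and its maximum is at most the best score plus \<open>\<eta>\<close>, so a best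
  score near \<open>1/q\<close> forces all \<open>B\<^sub>\<Gamma>\<close> to be nearly equal. Comparing \<open>\<Gamma>\<close> with its composite with a
  transposition gives \<open>N\<^sub>i\<^sub>j - N\<^sub>i\<^sub>'\<^sub>j \<approx> N\<^sub>i\<^sub>j\<^sub>' - N\<^sub>i\<^sub>'\<^sub>j\<^sub>'\<close>. Averaging this over \<open>j'\<close>, where
  the right-hand side is a difference of row sums that are close to \<open>1\<close>, shows that the rows of \<open>N\<close>
  nearly coincide, and hence that they are close to their \<open>a\<close>-weighted mean \<open>\<tau>\<close>.
\<close>

lemma near_trivial_of_max_alignment:
  fixes R :: "'q::finite \<Rightarrow> 'q \<Rightarrow> real"
  assumes nn: "\<And>i j. R i j \<ge> 0"
    and a: "\<And>i. a i \<ge> m" "m > 0" and a1: "(\<Sum>i\<in>UNIV. a i) = 1"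
  defines "\<tau> \<equiv> \<lambda>j. \<Sum>i\<in>UNIV. R i j"
  defines "\<eta> \<equiv> (\<Sum>i\<in>UNIV. \<bar>(\<Sum>j\<in>UNIV. R i j) - a i\<bar>) / m"
  shows "\<bar>R i j - a i * \<tau> j\<bar>
           \<le> CARD('q) * (fact CARD('q) * (max_alignment R - 1 / CARD('q) + 2 * \<eta>)) + 2 * \<eta>"
proof -
  define q where "q = real CARD('q)"
  define \<rho> where "\<rho> i = (\<Sum>j\<in>UNIV. R i j)" for i
  define N where "N i j = R i j / a i" for i j
  define B where "B \<Gamma> = 1 / q * (\<Sum>i\<in>UNIV. N i (\<Gamma> i))" for \<Gamma>
  \<comment> \<open>\<open>U\<close> bounds every \<open>B \<Gamma>\<close> from above, and \<open>\<delta>\<close> will bound every \<open>U - B \<Gamma>\<close>.\<close>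
  define U where "U = max_alignment R + \<eta>"
  define \<delta> where "\<delta> = fact CARD('q) * (max_alignment R - 1 / q + 2 * \<eta>)"
  let ?S = "{\<Gamma> :: 'q \<Rightarrow> 'q. \<Gamma> permutes UNIV}"
  have q1: "q \<ge> 1" unfolding q_def by (simp add: Suc_le_eq card_gt_0_iff)
  have apos: "a i > 0" for i using a(1)[of i] a(2) by linarith
  have \<eta>: "\<eta> = (\<Sum>i\<in>UNIV. \<bar>\<rho> i - a i\<bar> / m)" by (simp add: \<eta>_def \<rho>_def sum_divide_distrib)
  have ratio: "\<bar>\<rho> i - a i\<bar> / a i \<le> \<bar>\<rho> i - a i\<bar> / m" for i
    by (rule frac_le) (use a in auto)
  have ratios: "(\<Sum>i\<in>UNIV. \<bar>\<rho> i - a i\<bar> / a i) \<le> \<eta>" unfolding \<eta> by (rule sum_mono) (rule ratio)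
  have \<eta>0: "\<eta> \<ge> 0" unfolding \<eta> using a(2) by (intro sum_nonneg) auto
  have rowN: "(\<Sum>j\<in>UNIV. N i j) = \<rho> i / a i" for i by (simp add: N_def \<rho>_def sum_divide_distrib)
  have "\<rho> i / a i - 1 = (\<rho> i - a i) / a i" for i using apos[of i] by (simp add: field_simps)
  hence row1': "\<bar>\<rho> i / a i - 1\<bar> = \<bar>\<rho> i - a i\<bar> / a i" for i using apos[of i] by simp
  have row1: "\<bar>\<rho> i / a i - 1\<bar> \<le> \<eta>" for i
    unfolding row1' using apos
    by (intro order_trans[OF _ ratios] member_le_sum) (auto simp: less_imp_le)
  have \<eta>q: "\<eta> / q \<le> \<eta>" using divide_left_mono[of 1 q \<eta>] q1 \<eta>0 by simp
  have BU: "B \<Gamma> \<le> U" if \<Gamma>: "\<Gamma> permutes UNIV" for \<Gamma>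
  proof -
    have "(\<Sum>i\<in>UNIV. N i (\<Gamma> i)) \<le> (\<Sum>i\<in>UNIV. R i (\<Gamma> i) / \<rho> i + \<bar>\<rho> i - a i\<bar> / a i)"
    proof (rule sum_mono)
      fix i
      have "\<bar>R i (\<Gamma> i) / \<rho> i - R i (\<Gamma> i) / a i\<bar> \<le> \<bar>\<rho> i - a i\<bar> / a i"
        by (rule abs_ratio_diff_le) (use nn apos entry_le_row_sum[OF nn] in \<open>auto simp: \<rho>_def\<close>)
      thus "N i (\<Gamma> i) \<le> R i (\<Gamma> i) / \<rho> i + \<bar>\<rho> i - a i\<bar> / a i" unfolding N_def by linarith
    qed
    also have "\<dots> \<le> (\<Sum>i\<in>UNIV. R i (\<Gamma> i) / \<rho> i) + \<eta>" using ratios by (simp add: sum.distrib)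
    finally have "B \<Gamma> \<le> 1 / q * ((\<Sum>i\<in>UNIV. R i (\<Gamma> i) / \<rho> i) + \<eta>)"
      unfolding B_def using q1 by (intro mult_left_mono) auto
    also have "\<dots> = alignment R \<Gamma> + \<eta> / q" by (simp add: alignment_def q_def \<rho>_def field_simps)
    also have "\<dots> \<le> U" unfolding U_def using alignment_le_max[OF \<Gamma>, of R] q1 \<eta>0
      by (intro add_mono \<eta>q) auto
    finally show ?thesis .
  qed
  have sumB: "(\<Sum>\<Gamma>\<in>?S. B \<Gamma>) \<ge> fact CARD('q) * (1 / q - \<eta>)"
  proof -
    have "(\<Sum>\<Gamma>\<in>?S. B \<Gamma>) = 1 / q * (\<Sum>\<Gamma>\<in>?S. \<Sum>i\<in>UNIV. N i (\<Gamma> i))"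
      by (simp add: B_def sum_distrib_left)
    also have "(\<Sum>\<Gamma>\<in>?S. \<Sum>i\<in>UNIV. N i (\<Gamma> i)) = (\<Sum>i\<in>UNIV. \<Sum>\<Gamma>\<in>?S. N i (\<Gamma> i))"
      by (rule sum.swap)
    also have "\<dots> = (\<Sum>i\<in>UNIV. fact CARD('q) / q * (\<rho> i / a i))"
      by (rule sum.cong) (simp_all add: sum_over_permutations rowN q_def)
    also have "1 / q * \<dots> = fact CARD('q) / q * (1 / q * (\<Sum>i\<in>UNIV. \<rho> i / a i))"
      by (simp add: sum_distrib_left sum_divide_distrib)
    finally have e: "(\<Sum>\<Gamma>\<in>?S. B \<Gamma>) = fact CARD('q) / q * (1 / q * (\<Sum>i\<in>UNIV. \<rho> i / a i))" .
    have "(\<Sum>i\<in>(UNIV::'q set). 1 - \<eta>) \<le> (\<Sum>i\<in>UNIV. \<rho> i / a i)"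
      by (rule sum_mono) (use row1 in \<open>smt (verit)\<close>)
    hence "q * (1 - \<eta>) \<le> (\<Sum>i\<in>UNIV. \<rho> i / a i)" by (simp add: q_def)
    hence "1 - \<eta> \<le> 1 / q * (\<Sum>i\<in>UNIV. \<rho> i / a i)" using q1 by (simp add: field_simps)
    hence "fact CARD('q) / q * (1 - \<eta>) \<le> (\<Sum>\<Gamma>\<in>?S. B \<Gamma>)"
      unfolding e using q1 by (intro mult_left_mono) auto
    moreover have "1 / q - \<eta> \<le> 1 / q * (1 - \<eta>)"
      using \<eta>q by (simp add: diff_divide_distrib)
    hence "fact CARD('q) * (1 / q - \<eta>) \<le> fact CARD('q) * (1 / q * (1 - \<eta>))"
      by (intro mult_left_mono) auto
    ultimately show ?thesis by simp
  qed
  have lowB: "U - B \<Gamma> \<le> \<delta>" if \<Gamma>: "\<Gamma> permutes UNIV" for \<Gamma>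
  proof -
    \<comment> \<open>All these differences are nonnegative, so a single one is at most their sum.\<close>
    have "U - B \<Gamma> \<le> (\<Sum>\<Gamma>\<in>?S. U - B \<Gamma>)"
      by (rule member_le_sum) (use BU \<Gamma> in \<open>auto simp: finite_permutations\<close>)
    also have "\<dots> = fact CARD('q) * U - (\<Sum>\<Gamma>\<in>?S. B \<Gamma>)"
      by (simp add: sum_subtractf card_permutations[OF refl])
    also have "\<dots> \<le> fact CARD('q) * U - fact CARD('q) * (1 / q - \<eta>)" using sumB by simp
    also have "\<dots> = \<delta>" by (simp add: \<delta>_def U_def algebra_simps)
    finally show ?thesis .
  qed
  have \<delta>0: "\<delta> \<ge> 0" using lowB[OF permutes_id] BU[OF permutes_id] by linarith
  have swap: "\<bar>N i j + N i' j' - N i j' - N i' j\<bar> \<le> q * \<delta>" for i i' j j'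
  proof (cases "i = i' \<or> j = j'")
    case True
    thus ?thesis using q1 \<delta>0 by auto
  next
    case False
    then obtain \<Gamma> where \<Gamma>: "\<Gamma> permutes UNIV" "\<Gamma> i = j" "\<Gamma> i' = j'"
      using exists_permutation_two_points[of i i' j j' UNIV] by blast
    let ?\<Gamma>' = "\<Gamma> \<circ> Transposition.transpose i i'"
    have \<Gamma>': "?\<Gamma>' permutes UNIV" using \<Gamma>(1) by (intro permutes_compose permutes_swap_id) auto
    have U2: "(UNIV :: 'q set) = insert i (insert i' (UNIV - {i, i'}))" by auto
    have "(\<Sum>x\<in>UNIV. N x (\<Gamma> x)) = N i j + N i' j' + (\<Sum>x\<in>UNIV - {i, i'}. N x (\<Gamma> x))"
      by (subst U2) (use False \<Gamma> in auto)
    moreover have "(\<Sum>x\<in>UNIV. N x (?\<Gamma>' x)) = N i j' + N i' j + (\<Sum>x\<in>UNIV - {i, i'}. N x (?\<Gamma>' x))"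
      by (subst U2) (use False \<Gamma> in auto)
    moreover have "(\<Sum>x\<in>UNIV - {i, i'}. N x (?\<Gamma>' x)) = (\<Sum>x\<in>UNIV - {i, i'}. N x (\<Gamma> x))"
      by (rule sum.cong) (auto simp: Transposition.transpose_def)
    ultimately have "N i j + N i' j' - N i j' - N i' j = q * (B \<Gamma> - B ?\<Gamma>')"
      using q1 by (simp add: B_def field_simps)
    moreover have "\<bar>B \<Gamma> - B ?\<Gamma>'\<bar> \<le> \<delta>"
      using lowB[OF \<Gamma>(1)] lowB[OF \<Gamma>'] BU[OF \<Gamma>(1)] BU[OF \<Gamma>'] by linarith
    ultimately show ?thesis using q1 by (simp add: abs_mult)
  qed
  have col: "\<bar>N i j - N i' j\<bar> \<le> q * \<delta> + 2 * \<eta>" for i i' j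
  proof -
    have "(\<Sum>j'\<in>UNIV. N i j + N i' j' - N i j' - N i' j) = q * (N i j - N i' j) + (\<rho> i' / a i' - \<rho> i / a i)"
      by (simp add: sum_subtractf sum.distrib rowN q_def algebra_simps)
    hence "q * \<bar>N i j - N i' j\<bar> \<le> \<bar>\<Sum>j'\<in>UNIV. N i j + N i' j' - N i j' - N i' j\<bar> + \<bar>\<rho> i' / a i' - \<rho> i / a i\<bar>"
      using q1 by (simp add: abs_mult[of q, simplified, symmetric] flip: abs_mult)
    also have "\<bar>\<Sum>j'\<in>UNIV. N i j + N i' j' - N i j' - N i' j\<bar> \<le> (\<Sum>j'\<in>(UNIV::'q set). q * \<delta>)"
      by (rule order_trans[OF sum_abs], rule sum_mono) (rule swap)
    also have "\<dots> = q * (q * \<delta>)" by (simp add: q_def)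
    also have "\<bar>\<rho> i' / a i' - \<rho> i / a i\<bar> \<le> q * (2 * \<eta>)"
    proof -
      have "\<bar>\<rho> i' / a i' - \<rho> i / a i\<bar> \<le> 2 * \<eta>" using row1[of i] row1[of i'] by linarith
      also have "\<dots> \<le> q * (2 * \<eta>)" using q1 \<eta>0 mult_right_mono[of 1 q "2 * \<eta>"] by simp
      finally show ?thesis .
    qed
    finally have "q * \<bar>N i j - N i' j\<bar> \<le> q * (q * \<delta> + 2 * \<eta>)" by (simp add: algebra_simps)
    thus ?thesis using q1 by simp
  qed
  have RN: "R i j = a i * N i j" for i j using apos[of i] by (simp add: N_def)
  have "R i j - a i * \<tau> j = a i * (\<Sum>i'\<in>UNIV. a i' * (N i j - N i' j))"
    by (simp add: \<tau>_def RN right_diff_distrib sum_subtractf a1 flip: sum_distrib_right)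
  hence "\<bar>R i j - a i * \<tau> j\<bar> = a i * \<bar>\<Sum>i'\<in>UNIV. a i' * (N i j - N i' j)\<bar>"
    using apos[of i] by (simp add: abs_mult)
  also have "\<dots> \<le> 1 * (\<Sum>i'\<in>UNIV. a i' * (q * \<delta> + 2 * \<eta>))"
  proof (rule mult_mono)
    show "a i \<le> 1" unfolding a1[symmetric] by (rule member_le_sum) (use apos in \<open>auto simp: less_imp_le\<close>)
    show "\<bar>\<Sum>i'\<in>UNIV. a i' * (N i j - N i' j)\<bar> \<le> (\<Sum>i'\<in>UNIV. a i' * (q * \<delta> + 2 * \<eta>))"
      by (rule order_trans[OF sum_abs], rule sum_mono)
         (use apos col in \<open>auto simp: abs_mult less_imp_le intro!: mult_left_mono\<close>)
  qed auto
  also have "\<dots> = q * \<delta> + 2 * \<eta>" by (simp add: a1 flip: sum_distrib_right)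
  finally show ?thesis by (simp add: \<delta>_def q_def)
qed

lemma overlap_matrix_nonneg: "overlap_matrix n x y i j \<ge> 0"
  by (simp add: overlap_matrix_def)

lemma overlap_matrix_eq_sum:
  "overlap_matrix n x y i j = (\<Sum>v<n. of_bool (x v = i \<and> y v = j)) / n"
proof -
  have "{v. v < n \<and> x v = i \<and> y v = j} = {..<n} \<inter> {v. x v = i \<and> y v = j}" by auto
  thus ?thesis by (simp add: overlap_matrix_def sum.If_cases of_bool_def)
qed

definition label_freq :: "nat \<Rightarrow> (nat \<Rightarrow> 'q) \<Rightarrow> 'q \<Rightarrow> real" where
  "label_freq n x i = (\<Sum>v<n. of_bool (x v = i)) / n"

lemma label_freq_bounds: "0 \<le> label_freq n x i" "label_freq n x i \<le> 1"
proof -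
  show "0 \<le> label_freq n x i" by (auto simp: label_freq_def intro!: sum_nonneg divide_nonneg_nonneg)
  have "(\<Sum>v<n. of_bool (x v = i)) \<le> real n"
    using sum_bounded_above[of "{..<n}" "\<lambda>v. of_bool (x v = i)" "1::real"] by simp
  thus "label_freq n x i \<le> 1" by (cases "n = 0") (auto simp: label_freq_def divide_le_eq_1)
qed

lemma overlap_matrix_row_sum:
  fixes x y :: "nat \<Rightarrow> 'q::finite"
  shows "(\<Sum>j\<in>UNIV. overlap_matrix n x y i j) = label_freq n x i"
proof -
  have "(\<Sum>j\<in>UNIV. \<Sum>v<n. of_bool (x v = i \<and> y v = j)) = (\<Sum>v<n. \<Sum>j\<in>UNIV. of_bool (x v = i \<and> y v = j) :: real)"
    by (rule sum.swap)
  also have "\<dots> = (\<Sum>v<n. of_bool (x v = i))"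
    by (rule sum.cong) (auto simp: of_bool_conj simp flip: sum_distrib_left)
  finally show ?thesis by (simp add: overlap_matrix_eq_sum label_freq_def flip: sum_divide_distrib)
qed

lemma overlap_matrix_col_sum:
  fixes x y :: "nat \<Rightarrow> 'q::finite"
  shows "(\<Sum>i\<in>UNIV. overlap_matrix n x y i j) = label_freq n y j"
proof -
  have "overlap_matrix n x y i j = overlap_matrix n y x j i" for i
    by (simp add: overlap_matrix_def conj_commute conj_left_commute)
  thus ?thesis by (simp add: overlap_matrix_row_sum)
qed

lemma sum_label_freq:
  fixes x :: "nat \<Rightarrow> 'q::finite"
  assumes "n > 0"
  shows "(\<Sum>i\<in>UNIV. label_freq n x i) = 1"
proof -
  have "(\<Sum>i\<in>UNIV. \<Sum>v<n. of_bool (x v = i)) = (\<Sum>v<n. \<Sum>i\<in>UNIV. of_bool (x v = i) :: real)"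
    by (rule sum.swap)
  thus ?thesis using assms by (simp add: label_freq_def flip: sum_divide_distrib)
qed

lemma overlap_eq_max_alignment:
  fixes x y :: "nat \<Rightarrow> 'q::finite"
  assumes "n > 0"
  shows "overlap n x y = max_alignment (overlap_matrix n x y)"
proof -
  have c: "real (card {v. v < n \<and> x v = i}) = n * label_freq n x i" for i
  proof -
    have "{v. v < n \<and> x v = i} = {..<n} \<inter> {v. x v = i}" by auto
    thus ?thesis using assms by (simp add: label_freq_def sum.If_cases of_bool_def)
  qed
  show ?thesis
    unfolding overlap_def max_alignment_def alignment_def overlap_matrix_row_sum c
    using assms by (simp add: overlap_matrix_def)
qed

section \<open>Pair statistics of two labellings\<close>

text \<open>
  Averages over variables of a function of both labels are linear in the overlap matrix.
\<close>

lemma empirical_average: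
  fixes x y :: "nat \<Rightarrow> 'q::finite" and g :: "'q \<Rightarrow> 'q \<Rightarrow> real"
  shows "(\<Sum>v<n. g (x v) (y v)) / n = (\<Sum>i\<in>UNIV. \<Sum>j\<in>UNIV. overlap_matrix n x y i j * g i j)"
proof -
  have single: "g (x v) (y v) = (\<Sum>i\<in>UNIV. \<Sum>j\<in>UNIV. of_bool (x v = i \<and> y v = j) * g i j)" for v
    by (simp add: of_bool_conj mult.assoc flip: sum_distrib_left)
  have "(\<Sum>v<n. g (x v) (y v)) = (\<Sum>i\<in>UNIV. \<Sum>v<n. \<Sum>j\<in>UNIV. of_bool (x v = i \<and> y v = j) * g i j)"
    unfolding single by (rule sum.swap)
  also have "\<dots> = (\<Sum>i\<in>UNIV. \<Sum>j\<in>UNIV. \<Sum>v<n. of_bool (x v = i \<and> y v = j) * g i j)"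
    by (rule sum.cong[OF refl]) (rule sum.swap)
  finally show ?thesis
    by (simp add: overlap_matrix_eq_sum sum_divide_distrib sum_distrib_right)
qed

text \<open>
  The average runs over all ordered pairs of variables, including the diagonal, so that it is
  exactly a quadratic form in the overlap matrix.
\<close>

definition pair_average ::
    "nat \<Rightarrow> ('q \<Rightarrow> 'q \<Rightarrow> 'q \<Rightarrow> 'q \<Rightarrow> real) \<Rightarrow> (nat \<Rightarrow> 'q) \<times> (nat \<Rightarrow> 'q) \<Rightarrow> real" where
  "pair_average n h = (\<lambda>(x, y). (\<Sum>u<n. \<Sum>v<n. h (x u) (x v) (y u) (y v)) / (real n)\<^sup>2)"

lemma pair_average_eq:
  fixes x y :: "nat \<Rightarrow> 'q::finite"
  shows "pair_average n h (x, y) = (\<Sum>i\<in>UNIV. \<Sum>i'\<in>UNIV. overlap_matrix n x y i i' *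
           (\<Sum>j\<in>UNIV. \<Sum>j'\<in>UNIV. overlap_matrix n x y j j' * h i j i' j'))"
proof -
  define g where "g i i' = (\<Sum>j\<in>UNIV. \<Sum>j'\<in>UNIV. overlap_matrix n x y j j' * h i j i' j')" for i i'
  have "pair_average n h (x, y) = (\<Sum>u<n. (\<Sum>v<n. h (x u) (x v) (y u) (y v)) / n) / n"
    by (simp add: pair_average_def sum_divide_distrib power2_eq_square)
  also have "\<dots> = (\<Sum>u<n. g (x u) (y u)) / n"
    unfolding g_def by (simp only: empirical_average[of "\<lambda>j j'. h (x u) j (y u) j'" x y n for u])
  also have "\<dots> = (\<Sum>i\<in>UNIV. \<Sum>i'\<in>UNIV. overlap_matrix n x y i i' * g i i')"
    by (rule empirical_average)
  finally show ?thesis unfolding g_def .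
qed

text \<open>
  A quadratic form with bounded coefficients is Lipschitz in the \<open>\<ell>\<^sup>1\<close> norm on probability matrices:
  the two factors are exchanged one at a time.
\<close>

lemma quadratic_form_perturbation:
  fixes R P :: "'q::finite \<Rightarrow> 'q \<Rightarrow> real"
  assumes R: "\<And>i j. R i j \<ge> 0" "(\<Sum>i\<in>UNIV. \<Sum>j\<in>UNIV. R i j) = 1"
    and P: "\<And>i j. P i j \<ge> 0" "(\<Sum>i\<in>UNIV. \<Sum>j\<in>UNIV. P i j) = 1"
    and h: "\<And>i j i' j'. \<bar>h i j i' j'\<bar> \<le> K"
  shows "\<bar>(\<Sum>i\<in>UNIV. \<Sum>i'\<in>UNIV. R i i' * (\<Sum>j\<in>UNIV. \<Sum>j'\<in>UNIV. R j j' * h i j i' j'))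
         - (\<Sum>i\<in>UNIV. \<Sum>i'\<in>UNIV. P i i' * (\<Sum>j\<in>UNIV. \<Sum>j'\<in>UNIV. P j j' * h i j i' j'))\<bar>
         \<le> 2 * K * (\<Sum>i\<in>UNIV. \<Sum>j\<in>UNIV. \<bar>R i j - P i j\<bar>)"
proof -
  let ?U = "UNIV :: ('q \<times> 'q) set"
  define r where "r = (\<lambda>(i, j). R i j)"
  define p where "p = (\<lambda>(i, j). P i j)"
  define k where "k = (\<lambda>(i, i') (j, j'). h i j i' j')"
  have dbl: "(\<Sum>i\<in>UNIV. \<Sum>j\<in>UNIV. f i j) = (\<Sum>z\<in>?U. case z of (i, j) \<Rightarrow> f i j)" for f :: "'q \<Rightarrow> 'q \<Rightarrow> real"
    by (simp add: sum.cartesian_product UNIV_Times_UNIV[symmetric] del: UNIV_Times_UNIV)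
  have k: "\<bar>k z w\<bar> \<le> K" for z w using h by (simp add: k_def split: prod.split)
  have r: "r z \<ge> 0" "(\<Sum>z\<in>?U. r z) = 1" and p: "p z \<ge> 0" "(\<Sum>z\<in>?U. p z) = 1" for z
    using R P by (auto simp: r_def p_def dbl split: prod.split)
  have "(\<Sum>i\<in>UNIV. \<Sum>i'\<in>UNIV. R i i' * (\<Sum>j\<in>UNIV. \<Sum>j'\<in>UNIV. R j j' * h i j i' j')) = (\<Sum>z\<in>?U. r z * (\<Sum>w\<in>?U. r w * k z w))"
    by (simp add: dbl r_def k_def case_prod_unfold)
  moreover have "(\<Sum>i\<in>UNIV. \<Sum>i'\<in>UNIV. P i i' * (\<Sum>j\<in>UNIV. \<Sum>j'\<in>UNIV. P j j' * h i j i' j')) = (\<Sum>z\<in>?U. p z * (\<Sum>w\<in>?U. p w * k z w))"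
    by (simp add: dbl p_def k_def case_prod_unfold)
  moreover have "(\<Sum>i\<in>UNIV. \<Sum>j\<in>UNIV. \<bar>R i j - P i j\<bar>) = (\<Sum>z\<in>?U. \<bar>r z - p z\<bar>)"
    by (simp add: dbl p_def r_def case_prod_unfold)
  moreover have "\<bar>(\<Sum>z\<in>?U. r z * (\<Sum>w\<in>?U. r w * k z w)) - (\<Sum>z\<in>?U. p z * (\<Sum>w\<in>?U. p w * k z w))\<bar>
      \<le> 2 * K * (\<Sum>z\<in>?U. \<bar>r z - p z\<bar>)"
  proof -
    define D where "D = (\<Sum>z\<in>?U. \<bar>r z - p z\<bar>)"
    have avg: "\<bar>\<Sum>w\<in>?U. r w * k z w\<bar> \<le> K" for z
    proof -
      have "\<bar>\<Sum>w\<in>?U. r w * k z w\<bar> \<le> (\<Sum>w\<in>?U. r w * K)"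
        by (rule order_trans[OF sum_abs], rule sum_mono) (simp add: abs_mult abs_of_nonneg[OF r(1)] mult_left_mono[OF k r(1)])
      thus ?thesis by (simp add: r flip: sum_distrib_right)
    qed
    have 1: "\<bar>\<Sum>z\<in>?U. (r z - p z) * (\<Sum>w\<in>?U. r w * k z w)\<bar> \<le> D * K"
      unfolding D_def sum_distrib_right
      by (rule order_trans[OF sum_abs], rule sum_mono) (simp add: abs_mult mult_left_mono[OF avg abs_ge_zero])
    have diff: "\<bar>\<Sum>w\<in>?U. (r w - p w) * k z w\<bar> \<le> D * K" for z
      unfolding D_def sum_distrib_right
      by (rule order_trans[OF sum_abs], rule sum_mono) (simp add: abs_mult mult_left_mono[OF k abs_ge_zero])
    have "\<bar>\<Sum>z\<in>?U. p z * (\<Sum>w\<in>?U. (r w - p w) * k z w)\<bar> \<le> (\<Sum>z\<in>?U. p z * (D * K))"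
      by (rule order_trans[OF sum_abs], rule sum_mono) (simp add: abs_mult abs_of_nonneg[OF p(1)] mult_left_mono[OF diff p(1)])
    hence 2: "\<bar>\<Sum>z\<in>?U. p z * (\<Sum>w\<in>?U. (r w - p w) * k z w)\<bar> \<le> D * K"
      by (simp add: p flip: sum_distrib_right)
    have "(\<Sum>z\<in>?U. r z * (\<Sum>w\<in>?U. r w * k z w)) - (\<Sum>z\<in>?U. p z * (\<Sum>w\<in>?U. p w * k z w))
      = (\<Sum>z\<in>?U. (r z - p z) * (\<Sum>w\<in>?U. r w * k z w)) + (\<Sum>z\<in>?U. p z * (\<Sum>w\<in>?U. (r w - p w) * k z w))"
      by (simp add: left_diff_distrib right_diff_distrib sum_subtractf)
    thus ?thesis using 1 2 unfolding D_def[symmetric] by (simp add: mult.commute)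
  qed
  ultimately show ?thesis by simp
qed

text \<open>
  Expanding the square, the left side pairs the coefficients \<open>t\<^sub>u t\<^sub>v\<close> with the correlations
  \<open>C\<^sub>u\<^sub>v\<close> of \<open>a\<^sub>u\<close> and \<open>a\<^sub>v\<close> under \<open>M\<close>. By Cauchy-Schwarz only \<open>\<Sum>\<^sub>u\<^sub>v C\<^sub>u\<^sub>v\<^sup>2\<close> matters, and that sum
  factors over two independent samples. The bound is uniform in \<open>t\<close>, which is what lets it handle
  arbitrary estimators.
\<close>

lemma linear_statistic_le_replica_statistic:
  fixes a :: "nat \<Rightarrow> 's \<Rightarrow> real" and t :: "nat \<Rightarrow> real"
  assumes a: "\<And>u x. \<bar>a u x\<bar> \<le> 1" and t: "\<And>u. \<bar>t u\<bar> \<le> 1"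
  shows "(measure_pmf.expectation M (\<lambda>x. ((\<Sum>u<n. t u * a u x) / n)\<^sup>2))\<^sup>2
           \<le> measure_pmf.expectation (pair_pmf M M) (\<lambda>(x, y). ((\<Sum>u<n. a u x * a u y) / n)\<^sup>2)"
proof (cases "n = 0")
  case False
  hence n: "real n > 0" by simp
  let ?I = "{..<n} \<times> {..<n}"
  define C where "C = (\<lambda>(u, v). measure_pmf.expectation M (\<lambda>x. a u x * a v x))"
  have aa: "\<bar>a u x * a v x\<bar> \<le> 1" for u v x
    using mult_mono[OF a[of u x] a[of v x]] by (simp add: abs_mult)
  have int: "integrable (measure_pmf M) (\<lambda>x. a u x * a v x)" for u v
    by (rule integrable_pmf_bounded[OF aa])
  have sq: "(\<Sum>u<n. f u)\<^sup>2 = (\<Sum>(u, v)\<in>?I. f u * f v)" for f :: "nat \<Rightarrow> real"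
    by (simp add: power2_eq_square sum_product sum.cartesian_product)
  have "measure_pmf.expectation M (\<lambda>x. ((\<Sum>u<n. t u * a u x) / n)\<^sup>2)
     = measure_pmf.expectation M (\<lambda>x. (\<Sum>(u, v)\<in>?I. t u * t v * (a u x * a v x)) / (real n)\<^sup>2)"
    by (simp add: power_divide sq mult_ac)
  also have "\<dots> = (\<Sum>z\<in>?I. t (fst z) * t (snd z) * C z) / (real n)\<^sup>2"
    using int by (simp add: case_prod_unfold C_def)
  finally have e: "measure_pmf.expectation M (\<lambda>x. ((\<Sum>u<n. t u * a u x) / n)\<^sup>2)
     = (\<Sum>z\<in>?I. t (fst z) * t (snd z) * C z) / (real n)\<^sup>2" .
  have "(measure_pmf.expectation M (\<lambda>x. ((\<Sum>u<n. t u * a u x) / n)\<^sup>2))\<^sup>2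
     = (\<Sum>z\<in>?I. t (fst z) * t (snd z) * C z)\<^sup>2 / (real n)^4"
    unfolding e by (simp add: power_divide)
  also have "\<dots> \<le> (\<Sum>z\<in>?I. (t (fst z) * t (snd z))\<^sup>2) * (\<Sum>z\<in>?I. (C z)\<^sup>2) / (real n)^4"
    by (intro divide_right_mono Cauchy_Schwarz_ineq_sum) auto
  also have "\<dots> \<le> (\<Sum>z\<in>?I. 1) * (\<Sum>z\<in>?I. (C z)\<^sup>2) / (real n)^4"
  proof (intro divide_right_mono mult_right_mono sum_mono)
    fix z :: "nat \<times> nat"
    have "\<bar>t (fst z) * t (snd z)\<bar> \<le> 1"
      using mult_mono[OF t[of "fst z"] t[of "snd z"]] by (simp add: abs_mult)
    thus "(t (fst z) * t (snd z))\<^sup>2 \<le> 1" by (simp add: abs_square_le_1)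
  qed (auto intro: sum_nonneg)
  also have "\<dots> = (\<Sum>z\<in>?I. (C z)\<^sup>2) / (real n)\<^sup>2"
    using n by (simp add: field_simps power2_eq_square power4_eq_xxxx)
  also have "(\<Sum>z\<in>?I. (C z)\<^sup>2) = (\<Sum>z\<in>?I. measure_pmf.expectation (pair_pmf M M)
     (\<lambda>(x, y). (a (fst z) x * a (snd z) x) * (a (fst z) y * a (snd z) y)))"
    by (intro sum.cong refl)
       (subst expectation_pair_prod[OF aa aa], simp add: C_def case_prod_unfold power2_eq_square)
  also have "\<dots> / (real n)\<^sup>2 = measure_pmf.expectation (pair_pmf M M)
     (\<lambda>w. (\<Sum>z\<in>?I. case w of (x, y) \<Rightarrow> (a (fst z) x * a (snd z) x) * (a (fst z) y * a (snd z) y)) / (real n)\<^sup>2)"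
  proof (subst integral_divide_zero, subst Bochner_Integration.integral_sum)
    fix z :: "nat \<times> nat"
    have "\<bar>(a (fst z) x * a (snd z) x) * (a (fst z) y * a (snd z) y)\<bar> \<le> 1" for x y
      using mult_mono[OF aa[of "fst z" x "snd z"] aa[of "fst z" y "snd z"]] by (simp add: abs_mult)
    thus "integrable (measure_pmf (pair_pmf M M)) (\<lambda>w. case w of (x, y) \<Rightarrow> (a (fst z) x * a (snd z) x) * (a (fst z) y * a (snd z) y))"
      by (intro integrable_pmf_bounded[where B=1]) (simp split: prod.split)
  qed simp
  also have "\<dots> = measure_pmf.expectation (pair_pmf M M) (\<lambda>(x, y). ((\<Sum>u<n. a u x * a u y) / n)\<^sup>2)"
    by (rule arg_cong[where f = "measure_pmf.expectation _"])
       (simp add: fun_eq_iff power_divide sq case_prod_unfold mult_ac)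
  finally show ?thesis .
qed simp

section \<open>Exchangeable labellings\<close>

text \<open>
  A sequence of inference problems with an i.i.d. labelling of \<open>n\<close> variables as hidden variable,
  such that permuting the variables, together with a matching injective transformation of the
  observation, preserves the joint law. The equivalences are proved at this generality; factor
  graphs enter only through their symmetry under renaming of variables.
\<close>

locale exchangeable_labelling =
  fixes J :: "nat \<Rightarrow> ((nat \<Rightarrow> 'q::finite) \<times> 'g) pmf" and \<pi> :: "'q pmf"
  assumes prior: "n > 0 \<Longrightarrow> map_pmf fst (J n) = Pi_pmf {..<n} undefined (\<lambda>_. \<pi>)"
    and exchangeable: "n > 0 \<Longrightarrow> f permutes {..<n} \<Longrightarrow>
          \<exists>T. inj T \<and> map_pmf (\<lambda>(\<sigma>, G). (\<sigma> \<circ> f, T G)) (J n) = J n"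
    and full_support: "pmf \<pi> i > 0"
begin

abbreviation Rep :: "nat \<Rightarrow> ((nat \<Rightarrow> 'q) \<times> (nat \<Rightarrow> 'q)) pmf" where
  "Rep n \<equiv> replicas (J n)"

definition discrepancy :: "nat \<Rightarrow> (nat \<Rightarrow> 'q) \<times> (nat \<Rightarrow> 'q) \<Rightarrow> real" where
  "discrepancy n = (\<lambda>(x, y). \<Sum>i\<in>UNIV. \<Sum>j\<in>UNIV. \<bar>overlap_matrix n x y i j - pmf \<pi> i * pmf \<pi> j\<bar>)"

lemma discrepancy_nonneg: "discrepancy n z \<ge> 0"
  by (auto simp: discrepancy_def case_prod_unfold intro!: sum_nonneg)

lemma sum_pmf_prior: "(\<Sum>i\<in>UNIV. pmf \<pi> i) = 1"
  by (rule sum_pmf_eq_1) auto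

lemma sum_pmf_product: "(\<Sum>i\<in>UNIV. \<Sum>j\<in>UNIV. pmf \<pi> i * pmf \<pi> j) = 1"
  by (simp add: sum_pmf_prior flip: sum_distrib_left)

lemma sum_overlap_matrix:
  fixes x y :: "nat \<Rightarrow> 'q"
  assumes "n > 0"
  shows "(\<Sum>i\<in>UNIV. \<Sum>j\<in>UNIV. overlap_matrix n x y i j) = 1"
  by (simp add: overlap_matrix_row_sum sum_label_freq assms)

lemma discrepancy_le_2:
  assumes "n > 0"
  shows "\<bar>discrepancy n z\<bar> \<le> 2"
proof -
  obtain x y where z: "z = (x, y)" by (cases z)
  have "discrepancy n z \<le> (\<Sum>i\<in>UNIV. \<Sum>j\<in>UNIV. overlap_matrix n x y i j + pmf \<pi> i * pmf \<pi> j)"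
    unfolding z discrepancy_def prod.case
  proof (intro sum_mono)
    fix i j
    show "\<bar>overlap_matrix n x y i j - pmf \<pi> i * pmf \<pi> j\<bar> \<le> overlap_matrix n x y i j + pmf \<pi> i * pmf \<pi> j"
      using overlap_matrix_nonneg[of n x y i j] mult_nonneg_nonneg[OF pmf_nonneg[of \<pi> i] pmf_nonneg[of \<pi> j]]
      by linarith
  qed
  also have "\<dots> = 2" using sum_overlap_matrix[OF assms, of x y] sum_pmf_product by (simp add: sum.distrib)
  finally show ?thesis using discrepancy_nonneg[of n z] by simp
qed

lemma finite_prior:
  assumes "n > 0"
  shows "finite (set_pmf (map_pmf fst (J n)))"
  unfolding prior[OF assms]
  by (rule finite_subset[OF set_Pi_pmf_subset']) (auto intro!: finite_PiE_dflt)

lemma finite_Rep: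
  assumes "n > 0"
  shows "finite (set_pmf (Rep n))"
proof -
  let ?S = "set_pmf (map_pmf fst (J n))"
  have "fst ` set_pmf (Rep n) = ?S" "snd ` set_pmf (Rep n) = ?S"
    using map_fst_replicas[of "J n"] map_snd_replicas[of "J n"] by (metis set_map_pmf)+
  hence "set_pmf (Rep n) \<subseteq> ?S \<times> ?S" by (metis subset_fst_snd)
  thus ?thesis using finite_prior[OF assms] finite_subset by blast
qed

lemma integrable_Rep: "n > 0 \<Longrightarrow> integrable (measure_pmf (Rep n)) (f :: _ \<Rightarrow> real)"
  by (rule integrable_measure_pmf_finite[OF finite_Rep])

lemma integrable_prior: "n > 0 \<Longrightarrow> integrable (measure_pmf (map_pmf fst (J n))) (f :: _ \<Rightarrow> real)"
  by (rule integrable_measure_pmf_finite[OF finite_prior])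

lemma prior_one_point:
  assumes "u < n"
  shows "measure_pmf.expectation (map_pmf fst (J n)) (\<lambda>\<sigma>. h (\<sigma> u)) = (\<Sum>i\<in>UNIV. pmf \<pi> i * h i)"
proof -
  have n: "n > 0" using assms by simp
  have "measure_pmf.expectation (map_pmf fst (J n)) (\<lambda>\<sigma>. h (\<sigma> u))
      = measure_pmf.expectation (map_pmf (\<lambda>\<sigma>. \<sigma> u) (Pi_pmf {..<n} undefined (\<lambda>_. \<pi>))) h"
    unfolding prior[OF n] by simp
  also have "\<dots> = (\<Sum>i\<in>UNIV. pmf \<pi> i * h i)"
    using assms by (simp add: Pi_pmf_component integral_measure_pmf_real[of UNIV] mult.commute del: integral_map_pmf)
  finally show ?thesis .
qed

lemma prior_two_points:
  assumes "u < n" "v < n" "u \<noteq> v"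
  shows "measure_pmf.expectation (map_pmf fst (J n)) (\<lambda>\<sigma>. h (\<sigma> u) (\<sigma> v))
           = (\<Sum>i\<in>UNIV. \<Sum>j\<in>UNIV. pmf \<pi> i * pmf \<pi> j * h i j)"
proof -
  have n: "n > 0" using assms by simp
  have "measure_pmf.expectation (map_pmf fst (J n)) (\<lambda>\<sigma>. h (\<sigma> u) (\<sigma> v))
      = measure_pmf.expectation (map_pmf (\<lambda>\<sigma>. (\<sigma> u, \<sigma> v)) (Pi_pmf {..<n} undefined (\<lambda>_. \<pi>))) (\<lambda>(i, j). h i j)"
    unfolding prior[OF n] by simp
  also have "\<dots> = measure_pmf.expectation (pair_pmf \<pi> \<pi>) (\<lambda>(i, j). h i j)"
    using assms by (subst map_two_components_Pi_pmf) auto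
  also have "\<dots> = (\<Sum>z\<in>UNIV \<times> UNIV. (case z of (i, j) \<Rightarrow> h i j) * pmf (pair_pmf \<pi> \<pi>) z)"
    by (rule integral_measure_pmf_real) auto
  also have "\<dots> = (\<Sum>i\<in>UNIV. \<Sum>j\<in>UNIV. pmf \<pi> i * pmf \<pi> j * h i j)"
    by (subst sum.cartesian_product) (auto intro!: sum.cong simp: pmf_pair mult_ac)
  finally show ?thesis .
qed

text \<open>
  The weak law of large numbers for the prior: the centred indicators are pairwise uncorrelated, so
  the variance is at most \<open>1 / n\<close>.
\<close>

lemma label_freq_concentration:
  "(\<lambda>n. measure_pmf.expectation (map_pmf fst (J n)) (\<lambda>\<sigma>. \<bar>label_freq n \<sigma> i - pmf \<pi> i\<bar>)) \<longlonglongrightarrow> 0"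
proof (rule tendsto_sandwich[OF _ _ tendsto_const])
  show "\<forall>\<^sub>F n in sequentially. measure_pmf.expectation (map_pmf fst (J n)) (\<lambda>\<sigma>. \<bar>label_freq n \<sigma> i - pmf \<pi> i\<bar>)
      \<le> sqrt (1 / n)"
    using eventually_gt_at_top[of 0]
  proof eventually_elim
    case (elim n)
    let ?E = "measure_pmf.expectation (map_pmf fst (J n))"
    define a where "a k = of_bool (k = i) - pmf \<pi> i" for k
    have mean: "(\<Sum>k\<in>UNIV. pmf \<pi> k * a k) = 0"
      by (simp add: a_def right_diff_distrib sum_subtractf sum_pmf_prior flip: sum_distrib_right)
    have a1: "\<bar>a k\<bar> \<le> 1" for k using pmf_le_1[of \<pi> i] by (auto simp: a_def)
    have freq: "label_freq n \<sigma> i - pmf \<pi> i = (\<Sum>v<n. a (\<sigma> v)) / n" for \<sigma>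
      using elim by (simp add: a_def label_freq_def sum_subtractf diff_divide_distrib)
    have corr: "?E (\<lambda>\<sigma>. a (\<sigma> u) * a (\<sigma> v)) \<le> of_bool (u = v)" if "u < n" "v < n" for u v
    proof (cases "u = v")
      case True
      have "?E (\<lambda>\<sigma>. a (\<sigma> u) * a (\<sigma> v)) \<le> \<bar>?E (\<lambda>\<sigma>. a (\<sigma> u) * a (\<sigma> v))\<bar>" by simp
      also have "\<dots> \<le> 1" by (rule abs_expectation_le) (use a1 mult_mono[OF a1 a1] in \<open>simp add: abs_mult\<close>)
      finally show ?thesis using True by simp
    next
      case False
      have "?E (\<lambda>\<sigma>. a (\<sigma> u) * a (\<sigma> v)) = (\<Sum>k\<in>UNIV. \<Sum>l\<in>UNIV. (pmf \<pi> k * a k) * (pmf \<pi> l * a l))"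
        using that False by (subst prior_two_points) (auto simp: mult_ac)
      also have "\<dots> = 0" by (simp add: mean flip: sum_distrib_left)
      finally show ?thesis by simp
    qed
    have "(?E (\<lambda>\<sigma>. \<bar>label_freq n \<sigma> i - pmf \<pi> i\<bar>))\<^sup>2 \<le> ?E (\<lambda>\<sigma>. \<bar>label_freq n \<sigma> i - pmf \<pi> i\<bar>\<^sup>2)"
    proof (rule expectation_square_le)
      fix \<sigma> :: "nat \<Rightarrow> 'q"
      show "\<bar>\<bar>label_freq n \<sigma> i - pmf \<pi> i\<bar>\<bar> \<le> 1"
        using label_freq_bounds[of n \<sigma> i] pmf_le_1[of \<pi> i] pmf_nonneg[of \<pi> i]
        unfolding abs_idempotent by linarith
    qed
    also have "\<dots> = ?E (\<lambda>\<sigma>. (\<Sum>u<n. \<Sum>v<n. a (\<sigma> u) * a (\<sigma> v)) / (real n)\<^sup>2)"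
      by (simp add: freq power_divide power2_eq_square sum_product)
    also have "\<dots> = (\<Sum>u<n. \<Sum>v<n. ?E (\<lambda>\<sigma>. a (\<sigma> u) * a (\<sigma> v))) / (real n)\<^sup>2"
      using integrable_prior[OF elim] by (simp del: integral_map_pmf integrable_map_pmf_eq)
    also have "\<dots> \<le> (\<Sum>u<n. \<Sum>v<n. of_bool (u = v)) / (real n)\<^sup>2"
      by (intro divide_right_mono sum_mono corr) auto
    also have "\<dots> = 1 / n" by (simp add: power2_eq_square)
    finally show ?case by (rule real_le_rsqrt)
  qed
  show "(\<lambda>n. sqrt (1 / real n)) \<longlonglongrightarrow> 0"
    using tendsto_real_sqrt[OF lim_1_over_n] by simp
qed (auto intro!: always_eventually Bochner_Integration.integral_nonneg)

lemma Rep_permute: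
  assumes "n > 0" "f permutes {..<n}"
  shows "measure_pmf.expectation (Rep n) (\<lambda>(x, y). (H (x \<circ> f) (y \<circ> f) :: real))
           = measure_pmf.expectation (Rep n) (\<lambda>(x, y). H x y)"
proof -
  obtain T where "inj T" "map_pmf (\<lambda>(\<sigma>, G). (\<sigma> \<circ> f, T G)) (J n) = J n"
    using exchangeable[OF assms] by blast
  from replicas_invariant[OF this] have inv: "map_pmf (\<lambda>(x, y). (x \<circ> f, y \<circ> f)) (Rep n) = Rep n" .
  have "measure_pmf.expectation (Rep n) (\<lambda>(x, y). H x y)
      = measure_pmf.expectation (map_pmf (\<lambda>(x, y). (x \<circ> f, y \<circ> f)) (Rep n)) (\<lambda>(x, y). H x y)"
    by (simp only: inv)
  also have "\<dots> = measure_pmf.expectation (Rep n) (\<lambda>(x, y). H (x \<circ> f) (y \<circ> f))"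
    by (simp add: case_prod_unfold)
  finally show ?thesis ..
qed

lemma Rep_two_points:
  fixes h :: "'q \<Rightarrow> 'q \<Rightarrow> 'q \<Rightarrow> 'q \<Rightarrow> real"
  assumes "u < n" "v < n" "u \<noteq> v" "u' < n" "v' < n" "u' \<noteq> v'"
  shows "measure_pmf.expectation (Rep n) (\<lambda>(x, y). h (x u) (x v) (y u) (y v))
           = measure_pmf.expectation (Rep n) (\<lambda>(x, y). h (x u') (x v') (y u') (y v'))"
proof -
  obtain f where f: "f permutes {..<n}" "f u' = u" "f v' = v"
    using exists_permutation_two_points[of u' v' u v "{..<n}"] assms by auto
  have "n > 0" using assms by simp
  from Rep_permute[OF this f(1), of "\<lambda>x y. h (x u') (x v') (y u') (y v')"] show ?thesis
    by (simp add: f)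
qed

text \<open>
  All off-diagonal pairs have the same replica expectation, and the diagonal is a fraction \<open>1 / n\<close>
  of all pairs.
\<close>

lemma Rep_pair_average:
  fixes h :: "'q \<Rightarrow> 'q \<Rightarrow> 'q \<Rightarrow> 'q \<Rightarrow> real"
  assumes uv: "u < n" "v < n" "u \<noteq> v" and h: "\<And>i j i' j'. \<bar>h i j i' j'\<bar> \<le> K"
  shows "\<bar>measure_pmf.expectation (Rep n) (pair_average n h)
          - measure_pmf.expectation (Rep n) (\<lambda>(x, y). h (x u) (x v) (y u) (y v))\<bar> \<le> 2 * K / n"
proof -
  have n: "n > 0" using uv by simp
  define e where "e u v = measure_pmf.expectation (Rep n) (\<lambda>(x, y). h (x u) (x v) (y u) (y v))" for u v
  have eK: "\<bar>e u' v'\<bar> \<le> K" for u' v'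
    unfolding e_def by (rule abs_expectation_le) (auto simp: h split: prod.split)
  have d: "\<bar>e u' v' - e u v\<bar> \<le> of_bool (u' = v') * (2 * K)" if "u' < n" "v' < n" for u' v'
  proof (cases "u' = v'")
    case True
    thus ?thesis using eK[of u' v'] eK[of u v] by simp
  next
    case False
    thus ?thesis using Rep_two_points[of u' n v' u v h] uv that by (simp add: e_def)
  qed
  have "measure_pmf.expectation (Rep n) (pair_average n h) = (\<Sum>u'<n. \<Sum>v'<n. e u' v') / (real n)\<^sup>2"
    unfolding pair_average_def e_def case_prod_unfold using integrable_Rep[OF n] by simp
  also have "\<dots> - e u v = (\<Sum>u'<n. \<Sum>v'<n. e u' v' - e u v) / (real n)\<^sup>2"
    using n by (simp add: sum_subtractf power2_eq_square field_simps)
  finally have "\<bar>measure_pmf.expectation (Rep n) (pair_average n h) - e u v\<bar>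
      = \<bar>\<Sum>u'<n. \<Sum>v'<n. e u' v' - e u v\<bar> / (real n)\<^sup>2" by simp
  also have "\<dots> \<le> (\<Sum>u'<n. \<Sum>v'<n. of_bool (u' = v') * (2 * K)) / (real n)\<^sup>2"
    by (intro divide_right_mono order_trans[OF sum_abs] sum_mono d) auto
  also have "\<dots> = 2 * K / n" using n by (simp add: power2_eq_square)
  finally show ?thesis by (simp add: e_def)
qed

section \<open>Pair posteriors, collisions and the overlap matrix\<close>

definition trivial_overlap :: bool where
  "trivial_overlap \<longleftrightarrow> (\<lambda>n. measure_pmf.expectation (Rep n) (discrepancy n)) \<longlonglongrightarrow> 0"

lemma pair_average_near_product:
  assumes n: "n > 0" and h: "\<And>i j i' j'. \<bar>h i j i' j'\<bar> \<le> K"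
  shows "\<bar>pair_average n h z - (\<Sum>i\<in>UNIV. \<Sum>i'\<in>UNIV. pmf \<pi> i * pmf \<pi> i' *
            (\<Sum>j\<in>UNIV. \<Sum>j'\<in>UNIV. pmf \<pi> j * pmf \<pi> j' * h i j i' j'))\<bar> \<le> 2 * K * discrepancy n z"
proof (cases z)
  case (Pair x y)
  show ?thesis unfolding Pair pair_average_eq discrepancy_def prod.case
    by (rule quadratic_form_perturbation[OF overlap_matrix_nonneg sum_overlap_matrix[OF n] _ sum_pmf_product h])
       simp
qed

text \<open>
  If the overlap matrix is asymptotically \<open>\<pi>\<pi>\<^sup>T\<close>, then the four labels that two replicas give to two
  distinct variables are asymptotically independent with law \<open>\<pi>\<close>.
\<close>

lemma trivial_overlap_imp_product_limit:
  fixes h :: "'q \<Rightarrow> 'q \<Rightarrow> 'q \<Rightarrow> 'q \<Rightarrow> real"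
  assumes triv: trivial_overlap and uv: "distinct_variables u v" and h: "\<And>i j i' j'. \<bar>h i j i' j'\<bar> \<le> K"
  shows "(\<lambda>n. measure_pmf.expectation (Rep n) (\<lambda>(x, y). h (x (u n)) (x (v n)) (y (u n)) (y (v n))))
     \<longlonglongrightarrow> (\<Sum>i\<in>UNIV. \<Sum>i'\<in>UNIV. pmf \<pi> i * pmf \<pi> i' *
            (\<Sum>j\<in>UNIV. \<Sum>j'\<in>UNIV. pmf \<pi> j * pmf \<pi> j' * h i j i' j'))"
    (is "?L \<longlonglongrightarrow> ?l")
proof (rule LIM_zero_cancel, rule Lim_null_comparison)
  let ?e = "\<lambda>n. 2 * K * (1 / real n) + 2 * K * measure_pmf.expectation (Rep n) (discrepancy n)"
  show "\<forall>\<^sub>F n in sequentially. norm (?L n - ?l) \<le> ?e n"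
    using eventually_ge_at_top[of 2]
  proof eventually_elim
    case (elim n)
    hence n: "n > 0" by simp
    let ?a = "measure_pmf.expectation (Rep n) (pair_average n h)"
    have "\<bar>?a - ?L n\<bar> \<le> 2 * K / n"
      using uv elim by (intro Rep_pair_average h) (auto simp: distinct_variables_def)
    moreover have "\<bar>?a - ?l\<bar> \<le> 2 * K * measure_pmf.expectation (Rep n) (discrepancy n)"
    proof -
      have "\<bar>?a - ?l\<bar> = \<bar>measure_pmf.expectation (Rep n) (\<lambda>z. pair_average n h z - ?l)\<bar>"
        using integrable_Rep[OF n] by simp
      also have "\<dots> \<le> measure_pmf.expectation (Rep n) (\<lambda>z. \<bar>pair_average n h z - ?l\<bar>)"
        by (rule integral_abs_bound)
      also have "\<dots> \<le> measure_pmf.expectation (Rep n) (\<lambda>z. 2 * K * discrepancy n z)"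
        by (intro integral_mono integrable_Rep n pair_average_near_product h)
      finally show ?thesis by simp
    qed
    ultimately show ?case by simp
  qed
  have "?e \<longlonglongrightarrow> 2 * K * 0 + 2 * K * 0"
    by (intro tendsto_intros lim_1_over_n) (use triv in \<open>simp add: trivial_overlap_def\<close>)
  thus "?e \<longlonglongrightarrow> 0" by simp
qed

lemma pair_posterior_iff:
  assumes uv: "distinct_variables u v"
  shows "tendsto_in_prob (\<lambda>n. map_pmf snd (J n))
           (\<lambda>n G. measure_pmf.prob (posterior_of (J n) G) {\<sigma>. \<sigma> (u n) = i \<and> \<sigma> (v n) = j}) (pmf \<pi> i * pmf \<pi> j)
     \<longleftrightarrow> (\<lambda>n. measure_pmf.expectation (Rep n) (\<lambda>(x, y).
           of_bool (x (u n) = i \<and> x (v n) = j) * of_bool (y (u n) = i \<and> y (v n) = j))) \<longlonglongrightarrow> (pmf \<pi> i * pmf \<pi> j)\<^sup>2"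
proof -
  have prob: "measure_pmf.prob (posterior_of (J n) G) {\<sigma>. \<sigma> (u n) = i \<and> \<sigma> (v n) = j}
      = measure_pmf.expectation (posterior_of (J n) G) (\<lambda>\<sigma>. of_bool (\<sigma> (u n) = i \<and> \<sigma> (v n) = j))" for n G
    by (rule prob_eq_expectation_of_bool)
  show ?thesis unfolding prob
  proof (rule posterior_in_prob_iff[where B = 1])
    show "\<forall>\<^sub>F n in sequentially. measure_pmf.expectation (map_pmf fst (J n))
        (\<lambda>\<sigma>. of_bool (\<sigma> (u n) = i \<and> \<sigma> (v n) = j)) = pmf \<pi> i * pmf \<pi> j"
      using eventually_ge_at_top[of 2]
    proof eventually_elim
      case (elim n)
      hence "u n < n" "v n < n" "u n \<noteq> v n" using uv by (auto simp: distinct_variables_def)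
      from prior_two_points[OF this, of "\<lambda>k l. of_bool (k = i \<and> l = j)"] show ?case
        by (simp add: of_bool_conj mult.assoc[symmetric] flip: sum_distrib_right)
    qed
  qed simp
qed

lemma trivial_overlap_imp_pair_posterior:
  assumes "trivial_overlap" "distinct_variables u v"
  shows "tendsto_in_prob (\<lambda>n. map_pmf snd (J n))
           (\<lambda>n G. measure_pmf.prob (posterior_of (J n) G) {\<sigma>. \<sigma> (u n) = i \<and> \<sigma> (v n) = j}) (pmf \<pi> i * pmf \<pi> j)"
proof -
  define h :: "'q \<Rightarrow> 'q \<Rightarrow> 'q \<Rightarrow> 'q \<Rightarrow> real" where
    "h k l k' l' = of_bool (k = i \<and> l = j) * of_bool (k' = i \<and> l' = j)" for k l k' l'
  have hb: "\<bar>h k l k' l'\<bar> \<le> 1" for k l k' l' by (simp add: h_def)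
  define w where "w k a = pmf \<pi> k * of_bool (k = a)" for k a
  have w: "(\<Sum>k\<in>UNIV. w k a) = pmf \<pi> a" for a by (simp add: w_def)
  have "pmf \<pi> l * pmf \<pi> l' * h k l k' l' = of_bool (k = i) * of_bool (k' = i) * (w l j * w l' j)" for k k' l l'
    by (simp add: h_def w_def)
  hence "(\<Sum>l\<in>UNIV. \<Sum>l'\<in>UNIV. pmf \<pi> l * pmf \<pi> l' * h k l k' l') = of_bool (k = i) * of_bool (k' = i) * (pmf \<pi> j)\<^sup>2" for k k'
    by (simp only: w power2_eq_square flip: sum_distrib_left sum_distrib_right)
  hence "pmf \<pi> k * pmf \<pi> k' * (\<Sum>l\<in>UNIV. \<Sum>l'\<in>UNIV. pmf \<pi> l * pmf \<pi> l' * h k l k' l') = w k i * w k' i * (pmf \<pi> j)\<^sup>2" for k k'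
    by (simp add: w_def)
  hence e: "(\<Sum>k\<in>UNIV. \<Sum>k'\<in>UNIV. pmf \<pi> k * pmf \<pi> k' * (\<Sum>l\<in>UNIV. \<Sum>l'\<in>UNIV. pmf \<pi> l * pmf \<pi> l' * h k l k' l'))
     = (pmf \<pi> i * pmf \<pi> j)\<^sup>2"
    by (simp only: w power_mult_distrib power2_eq_square[of "pmf \<pi> i"] flip: sum_distrib_left sum_distrib_right)
  from trivial_overlap_imp_product_limit[OF assms, of h 1, OF hb] show ?thesis
    unfolding pair_posterior_iff[OF assms(2)] e unfolding h_def .
qed

text \<open>
  Both statistics of the collision criterion are linear in the joint law of the labels of two
  variables.
\<close>

lemma prob_eq_sum_pair_posterior:
  fixes M :: "(nat \<Rightarrow> 'q) pmf"
  shows "measure_pmf.prob M {\<sigma>. \<sigma> u = \<sigma> v} = (\<Sum>(i, j)\<in>UNIV. of_bool (i = j) * measure_pmf.prob M {\<sigma>. \<sigma> u = i \<and> \<sigma> v = j})"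
    and "(\<Sum>i\<in>UNIV. w i * measure_pmf.prob M {\<sigma>. \<sigma> u = i})
      = (\<Sum>(i, j)\<in>UNIV. w i * measure_pmf.prob M {\<sigma>. \<sigma> u = i \<and> \<sigma> v = j})"
proof -
  have U: "(UNIV :: ('q \<times> 'q) set) = UNIV \<times> UNIV" by simp
  have "measure_pmf.prob M {\<sigma>. \<sigma> u = \<sigma> v} = measure_pmf.prob M (\<Union>i\<in>UNIV. {\<sigma>. \<sigma> u = i \<and> \<sigma> v = i})"
    by (rule arg_cong[where f = "measure_pmf.prob M"]) auto
  also have "\<dots> = (\<Sum>i\<in>UNIV. measure_pmf.prob M {\<sigma>. \<sigma> u = i \<and> \<sigma> v = i})"
    by (rule measure_pmf.finite_measure_finite_Union) (auto simp: disjoint_family_on_def)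
  also have "\<dots> = (\<Sum>i\<in>UNIV. \<Sum>j\<in>UNIV. of_bool (i = j) * measure_pmf.prob M {\<sigma>. \<sigma> u = i \<and> \<sigma> v = j})"
    by simp
  finally show "measure_pmf.prob M {\<sigma>. \<sigma> u = \<sigma> v} = (\<Sum>(i, j)\<in>UNIV. of_bool (i = j) * measure_pmf.prob M {\<sigma>. \<sigma> u = i \<and> \<sigma> v = j})"
    by (simp only: U sum.cartesian_product)
  have "measure_pmf.prob M {\<sigma>. \<sigma> u = i} = (\<Sum>j\<in>UNIV. measure_pmf.prob M {\<sigma>. \<sigma> u = i \<and> \<sigma> v = j})" for i
  proof -
    have "{\<sigma>. \<sigma> u = i} = (\<Union>j\<in>UNIV. {\<sigma>. \<sigma> u = i \<and> \<sigma> v = j})" by auto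
    thus ?thesis
      by (simp only:) (rule measure_pmf.finite_measure_finite_Union, auto simp: disjoint_family_on_def)
  qed
  thus "(\<Sum>i\<in>UNIV. w i * measure_pmf.prob M {\<sigma>. \<sigma> u = i})
      = (\<Sum>(i, j)\<in>UNIV. w i * measure_pmf.prob M {\<sigma>. \<sigma> u = i \<and> \<sigma> v = j})"
    by (simp add: U sum.cartesian_product[symmetric] sum_distrib_left del: UNIV_Times_UNIV)
qed

lemma pair_posterior_imp_collision:
  assumes "\<And>i j. tendsto_in_prob (\<lambda>n. map_pmf snd (J n))
     (\<lambda>n G. measure_pmf.prob (posterior_of (J n) G) {\<sigma>. \<sigma> (u n) = i \<and> \<sigma> (v n) = j}) (pmf \<pi> i * pmf \<pi> j)"
  shows "tendsto_in_prob (\<lambda>n. map_pmf snd (J n))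
           (\<lambda>n G. measure_pmf.prob (posterior_of (J n) G) {\<sigma>. \<sigma> (u n) = \<sigma> (v n)}) (\<Sum>i\<in>UNIV. (pmf \<pi> i)\<^sup>2)"
    and "tendsto_in_prob (\<lambda>n. map_pmf snd (J n))
           (\<lambda>n G. \<Sum>i\<in>UNIV. pmf \<pi> i * measure_pmf.prob (posterior_of (J n) G) {\<sigma>. \<sigma> (u n) = i}) (\<Sum>i\<in>UNIV. (pmf \<pi> i)\<^sup>2)"
proof -
  have dbl: "(\<Sum>z\<in>UNIV. f (fst z) (snd z)) = (\<Sum>i\<in>UNIV. \<Sum>j\<in>UNIV. f i j)" for f :: "'q \<Rightarrow> 'q \<Rightarrow> real"
    by (simp add: sum.cartesian_product case_prod_unfold UNIV_Times_UNIV[symmetric] del: UNIV_Times_UNIV)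
  have lim: "tendsto_in_prob (\<lambda>n. map_pmf snd (J n))
      (\<lambda>n G. \<Sum>z\<in>UNIV. w z * measure_pmf.prob (posterior_of (J n) G) {\<sigma>. \<sigma> (u n) = fst z \<and> \<sigma> (v n) = snd z})
      (\<Sum>z\<in>UNIV. w z * (pmf \<pi> (fst z) * pmf \<pi> (snd z)))" for w :: "'q \<times> 'q \<Rightarrow> real"
    by (rule tendsto_in_prob_weighted_sum) (use assms in auto)
  have "(\<Sum>z\<in>UNIV. of_bool (fst z = snd z) * (pmf \<pi> (fst z) * pmf \<pi> (snd z))) = (\<Sum>i\<in>UNIV. (pmf \<pi> i)\<^sup>2)"
    by (subst dbl[of "\<lambda>i j. of_bool (i = j) * (pmf \<pi> i * pmf \<pi> j)"]) (simp add: power2_eq_square)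
  with lim[of "\<lambda>z. of_bool (fst z = snd z)"]
  show "tendsto_in_prob (\<lambda>n. map_pmf snd (J n))
           (\<lambda>n G. measure_pmf.prob (posterior_of (J n) G) {\<sigma>. \<sigma> (u n) = \<sigma> (v n)}) (\<Sum>i\<in>UNIV. (pmf \<pi> i)\<^sup>2)"
    by (simp only: prob_eq_sum_pair_posterior(1) case_prod_unfold)
  have "(\<Sum>z\<in>UNIV. pmf \<pi> (fst z) * (pmf \<pi> (fst z) * pmf \<pi> (snd z))) = (\<Sum>i\<in>UNIV. (pmf \<pi> i)\<^sup>2)"
    by (subst dbl[of "\<lambda>i j. pmf \<pi> i * (pmf \<pi> i * pmf \<pi> j)"])
       (simp add: power2_eq_square sum_pmf_prior flip: sum_distrib_left)
  moreover have "(\<Sum>i\<in>UNIV. pmf \<pi> i * measure_pmf.prob (posterior_of (J n) G) {\<sigma>. \<sigma> (u n) = i})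
      = (\<Sum>z\<in>UNIV. pmf \<pi> (fst z) * measure_pmf.prob (posterior_of (J n) G) {\<sigma>. \<sigma> (u n) = fst z \<and> \<sigma> (v n) = snd z})" for n G
    using prob_eq_sum_pair_posterior(2)[of "pmf \<pi>" "posterior_of (J n) G" "u n" "v n"] by (simp only: case_prod_unfold)
  ultimately show "tendsto_in_prob (\<lambda>n. map_pmf snd (J n))
           (\<lambda>n G. \<Sum>i\<in>UNIV. pmf \<pi> i * measure_pmf.prob (posterior_of (J n) G) {\<sigma>. \<sigma> (u n) = i}) (\<Sum>i\<in>UNIV. (pmf \<pi> i)\<^sup>2)"
    using lim[of "\<lambda>z. pmf \<pi> (fst z)"] by (simp only:)
qed

text \<open>
  A second moment computation: averaged over pairs of variables, the replica correlation of
  \<open>1{\<sigma>\<^sub>u = \<sigma>\<^sub>v}\<close> is \<open>\<Sum>\<^sub>i\<^sub>j R\<^sub>i\<^sub>j\<^sup>2\<close>, and that of \<open>\<pi>(\<sigma>\<^sub>u)\<close> is \<open>\<Sum>\<^sub>i\<^sub>j R\<^sub>i\<^sub>j \<pi>\<^sub>i \<pi>\<^sub>j\<close>. These are the terms of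
  the squared distance between \<open>R\<close> and \<open>\<pi>\<pi>\<^sup>T\<close>, and one choice of \<open>u\<close> and \<open>v\<close> decides their limits.
\<close>

lemma collision_imp_trivial_overlap:
  assumes uv: "distinct_variables u v"
    and c1: "tendsto_in_prob (\<lambda>n. map_pmf snd (J n))
           (\<lambda>n G. measure_pmf.prob (posterior_of (J n) G) {\<sigma>. \<sigma> (u n) = \<sigma> (v n)}) (\<Sum>i\<in>UNIV. (pmf \<pi> i)\<^sup>2)"
    and c2: "tendsto_in_prob (\<lambda>n. map_pmf snd (J n))
           (\<lambda>n G. \<Sum>i\<in>UNIV. pmf \<pi> i * measure_pmf.prob (posterior_of (J n) G) {\<sigma>. \<sigma> (u n) = i}) (\<Sum>i\<in>UNIV. (pmf \<pi> i)\<^sup>2)"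
  shows trivial_overlap
proof -
  define s where "s = (\<Sum>i\<in>UNIV. (pmf \<pi> i)\<^sup>2)"
  define h1 :: "'q \<Rightarrow> 'q \<Rightarrow> 'q \<Rightarrow> 'q \<Rightarrow> real" where "h1 i j i' j' = of_bool (i = j) * of_bool (i' = j')" for i j i' j'
  define h2 :: "'q \<Rightarrow> 'q \<Rightarrow> 'q \<Rightarrow> 'q \<Rightarrow> real" where "h2 i j i' j' = pmf \<pi> i * pmf \<pi> i'" for i j i' j'
  have h1: "\<bar>h1 i j i' j'\<bar> \<le> 1" for i j i' j' by (simp add: h1_def)
  have h2: "\<bar>h2 i j i' j'\<bar> \<le> 1" for i j i' j'
    using mult_mono[OF pmf_le_1[of \<pi> i] pmf_le_1[of \<pi> i']] by (simp add: h2_def)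
  let ?P = "\<lambda>n h. measure_pmf.expectation (Rep n) (\<lambda>(x, y). h (x (u n)) (x (v n)) (y (u n)) (y (v n)))"
  have prob1: "measure_pmf.prob (posterior_of (J n) G) {\<sigma>. \<sigma> (u n) = \<sigma> (v n)}
      = measure_pmf.expectation (posterior_of (J n) G) (\<lambda>\<sigma>. of_bool (\<sigma> (u n) = \<sigma> (v n)))" for n G
    by (rule prob_eq_expectation_of_bool)
  have prob2: "(\<Sum>i\<in>UNIV. pmf \<pi> i * measure_pmf.prob (posterior_of (J n) G) {\<sigma>. \<sigma> (u n) = i})
      = measure_pmf.expectation (posterior_of (J n) G) (\<lambda>\<sigma>. pmf \<pi> (\<sigma> (u n)))" for n G
  proof -
    have "measure_pmf.expectation (posterior_of (J n) G) (\<lambda>\<sigma>. pmf \<pi> (\<sigma> (u n)))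
       = measure_pmf.expectation (posterior_of (J n) G) (\<lambda>\<sigma>. \<Sum>i\<in>UNIV. pmf \<pi> i * indicator {\<sigma>. \<sigma> (u n) = i} \<sigma>)"
      by (rule Bochner_Integration.integral_cong) (simp_all add: indicator_def)
    thus ?thesis
      by (subst (asm) Bochner_Integration.integral_sum)
         (auto intro!: integrable_pmf_bounded[where B=1] simp: pmf_le_1 split: split_indicator)
  qed
  have ev: "eventually (\<lambda>n. u n < n \<and> v n < n \<and> u n \<noteq> v n) sequentially"
    using eventually_ge_at_top[of 2] by eventually_elim (use uv in \<open>auto simp: distinct_variables_def\<close>)
  have "(\<lambda>n. measure_pmf.expectation (Rep n) (\<lambda>(x, y). of_bool (x (u n) = x (v n)) * of_bool (y (u n) = y (v n)))) \<longlonglongrightarrow> s\<^sup>2"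
  proof (rule iffD1[OF posterior_in_prob_iff[where B = 1]])
    show "tendsto_in_prob (\<lambda>n. map_pmf snd (J n)) (\<lambda>n G. measure_pmf.expectation (posterior_of (J n) G)
        (\<lambda>\<sigma>. of_bool (\<sigma> (u n) = \<sigma> (v n)))) s"
      using c1 by (simp only: prob1 s_def)
    show "\<forall>\<^sub>F n in sequentially. measure_pmf.expectation (map_pmf fst (J n)) (\<lambda>\<sigma>. of_bool (\<sigma> (u n) = \<sigma> (v n))) = s"
      using ev
    proof eventually_elim
      case (elim n)
      thus ?case using prior_two_points[of "u n" n "v n" "\<lambda>i j. of_bool (i = j)"]
        by (simp add: s_def power2_eq_square)
    qed
  qed auto
  hence lim1: "(\<lambda>n. ?P n h1) \<longlonglongrightarrow> s\<^sup>2" by (simp only: h1_def)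
  have "(\<lambda>n. measure_pmf.expectation (Rep n) (\<lambda>(x, y). pmf \<pi> (x (u n)) * pmf \<pi> (y (u n)))) \<longlonglongrightarrow> s\<^sup>2"
  proof (rule iffD1[OF posterior_in_prob_iff[where B = 1]])
    show "tendsto_in_prob (\<lambda>n. map_pmf snd (J n)) (\<lambda>n G. measure_pmf.expectation (posterior_of (J n) G)
        (\<lambda>\<sigma>. pmf \<pi> (\<sigma> (u n)))) s"
      using c2 by (simp only: prob2 s_def)
    show "\<forall>\<^sub>F n in sequentially. measure_pmf.expectation (map_pmf fst (J n)) (\<lambda>\<sigma>. pmf \<pi> (\<sigma> (u n))) = s"
      using ev
    proof eventually_elim
      case (elim n)
      thus ?case using prior_one_point[of "u n" n "pmf \<pi>"] by (simp add: s_def power2_eq_square)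
    qed
  qed (auto simp: pmf_le_1)
  hence lim2: "(\<lambda>n. ?P n h2) \<longlonglongrightarrow> s\<^sup>2" by (simp only: h2_def)
  define F where "F n = (\<lambda>(x, y). \<Sum>i\<in>UNIV. \<Sum>j\<in>UNIV. (overlap_matrix n x y i j - pmf \<pi> i * pmf \<pi> j)\<^sup>2)" for n
  define q where "q = real CARD('q)"
  have F: "F n z = pair_average n h1 z - 2 * pair_average n h2 z + s\<^sup>2" if n: "n > 0" for n z
  proof (cases z)
    case (Pair x y)
    let ?R = "overlap_matrix n x y"
    have "s\<^sup>2 = (\<Sum>i\<in>UNIV. \<Sum>j\<in>UNIV. (pmf \<pi> i * pmf \<pi> j)\<^sup>2)"
      by (simp add: s_def power2_eq_square[of "sum _ _"] sum_product power_mult_distrib)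
    moreover have "pair_average n h1 z = (\<Sum>i\<in>UNIV. \<Sum>j\<in>UNIV. (?R i j)\<^sup>2)"
      unfolding Pair pair_average_eq by (simp add: h1_def mult_ac power2_eq_square flip: sum_distrib_left sum_distrib_right)
    moreover have "pair_average n h2 z = (\<Sum>i\<in>UNIV. \<Sum>j\<in>UNIV. ?R i j * (pmf \<pi> i * pmf \<pi> j))"
      unfolding Pair pair_average_eq h2_def
      by (simp add: sum_overlap_matrix[OF n] flip: sum_distrib_right)
    ultimately show ?thesis
      unfolding Pair F_def by (simp add: power2_diff sum.distrib sum_subtractf sum_distrib_left mult_ac)
  qed
  \<comment> \<open>The \<open>1 / n\<close> terms are the errors of \<open>Rep_pair_average\<close> for coefficients bounded by \<open>1\<close>.\<close>
  let ?e = "\<lambda>n. (?P n h1 + 2 * 1 * (1 / n)) - 2 * (?P n h2 - 2 * 1 * (1 / n)) + s\<^sup>2"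
  have FE: "eventually (\<lambda>n. measure_pmf.expectation (Rep n) (discrepancy n) \<le> sqrt (q\<^sup>2 * ?e n)) sequentially"
    using ev
  proof eventually_elim
    case (elim n)
    hence n: "n > 0" by simp
    let ?E = "measure_pmf.expectation (Rep n)"
    have "?E (F n) = ?E (pair_average n h1) - 2 * ?E (pair_average n h2) + s\<^sup>2"
      unfolding F[OF n, abs_def] using integrable_Rep[OF n] by simp
    also have "\<dots> \<le> ?e n"
      using Rep_pair_average[of "u n" n "v n" h1, OF _ _ _ h1] Rep_pair_average[of "u n" n "v n" h2, OF _ _ _ h2] elim
      by simp
    finally have Fe: "?E (F n) \<le> ?e n" .
    have "(discrepancy n z)\<^sup>2 \<le> q\<^sup>2 * F n z" for z
    proof (cases z)
      case (Pair x y)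
      let ?d = "\<lambda>(i, j). \<bar>overlap_matrix n x y i j - pmf \<pi> i * pmf \<pi> j\<bar>"
      have "(\<Sum>w\<in>UNIV \<times> UNIV. ?d w)\<^sup>2 = (\<Sum>w\<in>UNIV \<times> UNIV. 1 * ?d w)\<^sup>2" by simp
      also have "\<dots> \<le> (\<Sum>w\<in>(UNIV :: 'q set) \<times> (UNIV :: 'q set). 1\<^sup>2) * (\<Sum>w\<in>UNIV \<times> UNIV. (?d w)\<^sup>2)"
        by (rule Cauchy_Schwarz_ineq_sum)
      also have "(\<Sum>w\<in>(UNIV :: 'q set) \<times> (UNIV :: 'q set). 1\<^sup>2) = q\<^sup>2"
        by (simp add: q_def power2_eq_square card_cartesian_product del: UNIV_Times_UNIV)
      finally show ?thesis
        unfolding Pair discrepancy_def F_def by (simp add: sum.cartesian_product case_prod_unfold)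
    qed
    hence "?E (\<lambda>z. (discrepancy n z)\<^sup>2) \<le> ?E (\<lambda>z. q\<^sup>2 * F n z)"
      by (intro integral_mono integrable_Rep n)
    also have "\<dots> \<le> q\<^sup>2 * ?e n" using Fe by (simp add: mult_left_mono)
    finally have "?E (\<lambda>z. (discrepancy n z)\<^sup>2) \<le> q\<^sup>2 * ?e n" .
    moreover have "(?E (discrepancy n))\<^sup>2 \<le> ?E (\<lambda>z. (discrepancy n z)\<^sup>2)"
    proof -
      have "0 \<le> measure_pmf.variance (Rep n) (discrepancy n)" by simp
      thus ?thesis using measure_pmf.variance_eq[OF integrable_Rep[OF n] integrable_Rep[OF n], of "discrepancy n"] by simp
    qed
    ultimately show ?case by (intro real_le_rsqrt) linarith
  qed
  show ?thesis unfolding trivial_overlap_def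
  proof (rule tendsto_sandwich[OF _ FE tendsto_const])
    have "(\<lambda>n. sqrt (q\<^sup>2 * ?e n)) \<longlonglongrightarrow> sqrt (q\<^sup>2 * ((s\<^sup>2 + 2 * 1 * 0) - 2 * (s\<^sup>2 - 2 * 1 * 0) + s\<^sup>2))"
      by (intro tendsto_intros lim1 lim2 lim_1_over_n)
    thus "(\<lambda>n. sqrt (q\<^sup>2 * ?e n)) \<longlonglongrightarrow> 0" by simp
  qed (auto intro!: always_eventually Bochner_Integration.integral_nonneg discrepancy_nonneg)
qed

section \<open>Weak recovery\<close>

definition recovery_impossible :: bool where
  "recovery_impossible \<longleftrightarrow> (\<forall>est :: nat \<Rightarrow> 'g \<Rightarrow> nat \<Rightarrow> 'q.
     (\<lambda>n. measure_pmf.expectation (J n) (\<lambda>(\<sigma>, G). overlap n \<sigma> (est n G))) \<longlonglongrightarrow> 1 / CARD('q))"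

lemma prior_weight_bound: "\<exists>m>0. \<forall>i. m \<le> pmf \<pi> i"
proof (intro exI conjI allI)
  show "Min (range (pmf \<pi>)) > 0" using full_support by (subst Min_gr_iff) auto
  show "Min (range (pmf \<pi>)) \<le> pmf \<pi> i" for i by (rule Min_le) auto
qed

lemma overlap_bounds:
  fixes x y :: "nat \<Rightarrow> 'q"
  assumes "n > 0"
  shows "\<bar>overlap n x y\<bar> \<le> 1"
  using max_alignment_bounds[of "overlap_matrix n x y", OF overlap_matrix_nonneg] overlap_eq_max_alignment[OF assms, of x y]
  by simp

text \<open>
  The entry minus its product prediction is a linear statistic \<open>Z\<close> of the centred indicators of
  label \<open>i\<close>, with coefficients that are fixed once \<open>G\<close> is. Two applications of
  \<open>(E X)\<^sup>2 \<le> E X\<^sup>2\<close> and \<open>linear_statistic_le_replica_statistic\<close> bound the fourth power of \<open>E \<bar>Z\<bar>\<close>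
  by the second moment of the corresponding replica statistic \<open>Y\<close>. Since the indicators are centred,
  \<open>Y\<close> is a combination of entries of \<open>R - \<pi>\<pi>\<^sup>T\<close> with coefficients at most \<open>1\<close>.
\<close>

lemma estimator_decorrelation:
  fixes est :: "nat \<Rightarrow> 'g \<Rightarrow> nat \<Rightarrow> 'q"
  assumes n: "n > 0"
  shows "measure_pmf.expectation (J n)
           (\<lambda>(\<sigma>, G). \<bar>overlap_matrix n \<sigma> (est n G) i j - pmf \<pi> i * label_freq n (est n G) j\<bar>)
           \<le> sqrt (sqrt (measure_pmf.expectation (Rep n) (discrepancy n)))"
proof -
  define a where "a k = of_bool (k = i) - pmf \<pi> i" for k
  define Z where "Z \<sigma> \<tau> = (\<Sum>v<n. of_bool (\<tau> v = j) * a (\<sigma> v)) / n" for \<sigma> \<tau> :: "nat \<Rightarrow> 'q"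
  define Y where "Y = (\<lambda>(x, y). (\<Sum>v<n. a (x v) * a (y v)) / n)"
  have a1: "\<bar>a k\<bar> \<le> 1" for k using pmf_le_1[of \<pi> i] by (auto simp: a_def)
  have average: "\<bar>(\<Sum>v<n. f v) / n\<bar> \<le> 1" if "\<And>v. \<bar>f v\<bar> \<le> 1" for f :: "nat \<Rightarrow> real"
  proof -
    have "\<bar>\<Sum>v<n. f v\<bar> \<le> (\<Sum>v<n. 1)" by (rule order_trans[OF sum_abs], rule sum_mono) (rule that)
    thus ?thesis using n by simp
  qed
  have Z1: "\<bar>Z \<sigma> \<tau>\<bar> \<le> 1" for \<sigma> \<tau> unfolding Z_def by (rule average) (use a1 in auto)
  have aa: "\<bar>a k * a l\<bar> \<le> 1" for k l using mult_mono[OF a1 a1] by (simp add: abs_mult)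
  have Y1: "\<bar>Y z\<bar> \<le> 1" for z unfolding Y_def by (cases z) (simp only: prod.case, rule average, rule aa)
  have Zeq: "overlap_matrix n \<sigma> \<tau> i j - pmf \<pi> i * label_freq n \<tau> j = Z \<sigma> \<tau>" for \<sigma> \<tau>
    by (simp add: overlap_matrix_eq_sum label_freq_def Z_def a_def right_diff_distrib sum_subtractf
          diff_divide_distrib of_bool_conj mult.commute flip: sum_distrib_left)
  have sq1: "\<bar>w\<^sup>2\<bar> \<le> 1" if "\<bar>w\<bar> \<le> 1" for w :: real
    using that by (simp add: abs_square_le_1)
  let ?EG = "measure_pmf.expectation (map_pmf snd (J n))"
  let ?post = "\<lambda>G. posterior_of (J n) G"
  have "(measure_pmf.expectation (J n) (\<lambda>(\<sigma>, G). \<bar>Z \<sigma> (est n G)\<bar>))\<^sup>2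
      \<le> measure_pmf.expectation (J n) (\<lambda>z. (case z of (\<sigma>, G) \<Rightarrow> \<bar>Z \<sigma> (est n G)\<bar>)\<^sup>2)"
    by (rule expectation_square_le[where B = 1]) (auto simp: Z1)
  also have "\<dots> = measure_pmf.expectation (J n) (\<lambda>(\<sigma>, G). (Z \<sigma> (est n G))\<^sup>2)"
    by (simp add: case_prod_unfold)
  also have "\<dots> = ?EG (\<lambda>G. measure_pmf.expectation (?post G) (\<lambda>\<sigma>. (Z \<sigma> (est n G))\<^sup>2))"
    by (rule expectation_posterior[symmetric, where B = 1]) (rule sq1, rule Z1)
  finally have 1: "(measure_pmf.expectation (J n) (\<lambda>(\<sigma>, G). \<bar>Z \<sigma> (est n G)\<bar>))\<^sup>2
      \<le> ?EG (\<lambda>G. measure_pmf.expectation (?post G) (\<lambda>\<sigma>. (Z \<sigma> (est n G))\<^sup>2))" (is "_ \<le> ?EZ") .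
  have postZ: "\<bar>measure_pmf.expectation (?post G) (\<lambda>\<sigma>. (Z \<sigma> (est n G))\<^sup>2)\<bar> \<le> 1" for G
    by (rule abs_expectation_le) (rule sq1, rule Z1)
  have "?EZ\<^sup>2 \<le> ?EG (\<lambda>G. (measure_pmf.expectation (?post G) (\<lambda>\<sigma>. (Z \<sigma> (est n G))\<^sup>2))\<^sup>2)"
    by (rule expectation_square_le[where B = 1]) (rule postZ)
  also have "\<dots> \<le> ?EG (\<lambda>G. measure_pmf.expectation (pair_pmf (?post G) (?post G)) (\<lambda>z. (Y z)\<^sup>2))"
  proof (rule integral_mono)
    fix G
    show "(measure_pmf.expectation (?post G) (\<lambda>\<sigma>. (Z \<sigma> (est n G))\<^sup>2))\<^sup>2
        \<le> measure_pmf.expectation (pair_pmf (?post G) (?post G)) (\<lambda>z. (Y z)\<^sup>2)"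
      using linear_statistic_le_replica_statistic[of "\<lambda>v \<sigma>. a (\<sigma> v)" "\<lambda>v. of_bool (est n G v = j)" "?post G" n] a1
      by (simp add: Z_def Y_def case_prod_unfold)
  qed (auto intro!: integrable_pmf_bounded[where B = 1] abs_expectation_le sq1 postZ Y1 simp del: integrable_map_pmf_eq)
  also have "\<dots> = measure_pmf.expectation (Rep n) (\<lambda>z. (Y z)\<^sup>2)"
    by (rule expectation_replicas[symmetric, where B = 1]) (rule sq1, rule Y1)
  also have "\<dots> \<le> measure_pmf.expectation (Rep n) (discrepancy n)"
  proof (intro integral_mono integrable_Rep n)
    fix z :: "(nat \<Rightarrow> 'q) \<times> (nat \<Rightarrow> 'q)"
    obtain x y where z: "z = (x, y)" by (cases z)
    have mean: "(\<Sum>k\<in>UNIV. pmf \<pi> k * a k) = 0"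
      by (simp add: a_def right_diff_distrib sum_subtractf sum_pmf_prior flip: sum_distrib_right)
    have "(\<Sum>k\<in>UNIV. \<Sum>l\<in>UNIV. (pmf \<pi> k * pmf \<pi> l) * (a k * a l)) = (\<Sum>k\<in>UNIV. \<Sum>l\<in>UNIV. (pmf \<pi> k * a k) * (pmf \<pi> l * a l))"
      by (simp add: mult_ac)
    hence zero: "(\<Sum>k\<in>UNIV. \<Sum>l\<in>UNIV. (pmf \<pi> k * pmf \<pi> l) * (a k * a l)) = 0"
      by (simp add: mean flip: sum_product)
    \<comment> \<open>The product matrix can be subtracted because it pairs to zero with centred indicators.\<close>
    have "Y z = (\<Sum>k\<in>UNIV. \<Sum>l\<in>UNIV. (overlap_matrix n x y k l - pmf \<pi> k * pmf \<pi> l) * (a k * a l))"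
      using zero by (simp add: Y_def z empirical_average[of "\<lambda>k l. a k * a l"] left_diff_distrib sum_subtractf)
    also have "\<bar>\<dots>\<bar> \<le> discrepancy n z"
      unfolding discrepancy_def z prod.case
    proof (intro order_trans[OF sum_abs] sum_mono)
      fix k l
      show "\<bar>(overlap_matrix n x y k l - pmf \<pi> k * pmf \<pi> l) * (a k * a l)\<bar> \<le> \<bar>overlap_matrix n x y k l - pmf \<pi> k * pmf \<pi> l\<bar>"
        using mult_left_mono[OF aa[of k l] abs_ge_zero[of "overlap_matrix n x y k l - pmf \<pi> k * pmf \<pi> l"]]
        by (simp only: abs_mult mult_1_right)
    qed
    finally have "\<bar>Y z\<bar> \<le> discrepancy n z" .
    moreover have "(Y z)\<^sup>2 \<le> \<bar>Y z\<bar>"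
      using mult_left_mono[OF Y1[of z] abs_ge_zero[of "Y z"]] by (simp add: power2_eq_square)
    ultimately show "(Y z)\<^sup>2 \<le> discrepancy n z" by linarith
  qed
  finally have 2: "?EZ\<^sup>2 \<le> measure_pmf.expectation (Rep n) (discrepancy n)" .
  have "measure_pmf.expectation (J n) (\<lambda>(\<sigma>, G). \<bar>Z \<sigma> (est n G)\<bar>) \<le> sqrt ?EZ"
    using 1 by (rule real_le_rsqrt)
  also have "\<dots> \<le> sqrt (sqrt (measure_pmf.expectation (Rep n) (discrepancy n)))"
    using real_le_rsqrt[OF 2] by (rule real_sqrt_le_mono)
  finally show ?thesis by (simp only: Zeq)
qed

lemma trivial_overlap_imp_recovery_impossible:
  assumes trivial_overlap
  shows recovery_impossible
  unfolding recovery_impossible_def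
proof (rule allI, rule LIM_zero_cancel)
  fix est :: "nat \<Rightarrow> 'g \<Rightarrow> nat \<Rightarrow> 'q"
  obtain m where m: "m > 0" "\<And>i. m \<le> pmf \<pi> i" using prior_weight_bound by blast
  let ?D = "\<lambda>n. measure_pmf.expectation (Rep n) (discrepancy n)"
  let ?e = "\<lambda>n. 2 / m * (\<Sum>i\<in>(UNIV::'q set). \<Sum>j\<in>(UNIV::'q set). sqrt (sqrt (?D n)))"
  show "(\<lambda>n. measure_pmf.expectation (J n) (\<lambda>(\<sigma>, G). overlap n \<sigma> (est n G)) - 1 / CARD('q)) \<longlonglongrightarrow> 0"
  proof (rule Lim_null_comparison)
    show "\<forall>\<^sub>F n in sequentially. norm (measure_pmf.expectation (J n) (\<lambda>(\<sigma>, G). overlap n \<sigma> (est n G)) - 1 / CARD('q)) \<le> ?e n"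
      using eventually_gt_at_top[of 0]
    proof eventually_elim
      case (elim n)
      let ?E = "measure_pmf.expectation (J n)"
      let ?z = "\<lambda>(\<sigma>, G) i j. \<bar>overlap_matrix n \<sigma> (est n G) i j - pmf \<pi> i * label_freq n (est n G) j\<bar>"
      have int: "integrable (measure_pmf (J n)) (\<lambda>(\<sigma>, G). overlap n \<sigma> (est n G))"
        by (rule integrable_pmf_bounded[where B = 1]) (use overlap_bounds[OF elim] in auto)
      have b: "\<bar>?z w i j\<bar> \<le> 2" for w i j
      proof -
        obtain \<sigma> G where w: "w = (\<sigma>, G)" by (cases w)
        have R: "0 \<le> overlap_matrix n \<sigma> (est n G) i j"  by (rule overlap_matrix_nonneg)
        have "overlap_matrix n \<sigma> (est n G) i j \<le> label_freq n \<sigma> i"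
          using entry_le_row_sum[of "overlap_matrix n \<sigma> (est n G)" i j] by (simp add: overlap_matrix_nonneg overlap_matrix_row_sum)
        moreover have "0 \<le> pmf \<pi> i * label_freq n (est n G) j" "pmf \<pi> i * label_freq n (est n G) j \<le> 1"
          using label_freq_bounds[of n "est n G" j] pmf_le_1[of \<pi> i] by (auto intro: mult_le_one)
        ultimately show ?thesis using R label_freq_bounds[of n \<sigma> i] unfolding w prod.case abs_idempotent by linarith
      qed
      have intz: "integrable (measure_pmf (J n)) (\<lambda>w. ?z w i j)" for i j
        by (rule integrable_pmf_bounded[OF b])
      have "?E (\<lambda>(\<sigma>, G). overlap n \<sigma> (est n G)) - 1 / CARD('q) = ?E (\<lambda>w. (case w of (\<sigma>, G) \<Rightarrow> overlap n \<sigma> (est n G)) - 1 / CARD('q))"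
        using int by simp
      hence "\<bar>?E (\<lambda>(\<sigma>, G). overlap n \<sigma> (est n G)) - 1 / CARD('q)\<bar> \<le> ?E (\<lambda>w. \<bar>(case w of (\<sigma>, G) \<Rightarrow> overlap n \<sigma> (est n G)) - 1 / CARD('q)\<bar>)"
        by (simp only: integral_abs_bound)
      also have "\<dots> \<le> ?E (\<lambda>w. 2 / m * (\<Sum>i\<in>UNIV. \<Sum>j\<in>UNIV. ?z w i j))"
      proof (rule integral_mono)
        fix w :: "(nat \<Rightarrow> 'q) \<times> 'g"
        obtain \<sigma> G where w: "w = (\<sigma>, G)" by (cases w)
        show "\<bar>(case w of (\<sigma>, G) \<Rightarrow> overlap n \<sigma> (est n G)) - 1 / CARD('q)\<bar> \<le> 2 / m * (\<Sum>i\<in>UNIV. \<Sum>j\<in>UNIV. ?z w i j)"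
          using max_alignment_near_trivial[of "overlap_matrix n \<sigma> (est n G)" m "pmf \<pi>",
              OF overlap_matrix_nonneg sum_overlap_matrix[OF elim] m(2) m(1)]
          by (simp add: w overlap_eq_max_alignment[OF elim] overlap_matrix_col_sum)
      qed (use int intz in auto)
      also have "\<dots> = 2 / m * (\<Sum>i\<in>UNIV. \<Sum>j\<in>UNIV. ?E (\<lambda>w. ?z w i j))"
        using intz by simp
      also have "\<dots> \<le> ?e n"
        using estimator_decorrelation[OF elim, of est] m(1)
        by (intro mult_left_mono sum_mono) (auto simp: case_prod_unfold)
      finally show ?case by simp
    qed
    have "?e \<longlonglongrightarrow> 2 / m * (\<Sum>i\<in>(UNIV::'q set). \<Sum>j\<in>(UNIV::'q set). sqrt (sqrt 0))"
      by (intro tendsto_intros) (use assms in \<open>simp add: trivial_overlap_def\<close>)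
    thus "?e \<longlonglongrightarrow> 0" by simp
  qed
qed

text \<open>
  The second replica can be read as an estimate drawn at random given \<open>G\<close>, independently of the
  first; some fixed value does at least as well for each \<open>G\<close>.
\<close>

lemma exists_estimator_beating_replica:
  assumes n: "n > 0"
  shows "\<exists>t :: 'g \<Rightarrow> nat \<Rightarrow> 'q. measure_pmf.expectation (Rep n) (\<lambda>(x, y). overlap n x y)
           \<le> measure_pmf.expectation (J n) (\<lambda>(\<sigma>, G). overlap n \<sigma> (t G))"
proof -
  let ?post = "posterior_of (J n)"
  let ?gain = "\<lambda>G \<tau>. measure_pmf.expectation (?post G) (\<lambda>\<sigma>. overlap n \<sigma> \<tau>)"
  have ob: "\<bar>overlap n x y\<bar> \<le> 1" for x y :: "nat \<Rightarrow> 'q" by (rule overlap_bounds[OF n])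
  have gb: "\<bar>?gain G \<tau>\<bar> \<le> 1" for G \<tau> by (rule abs_expectation_le) (rule ob)
  have "\<exists>\<tau>. measure_pmf.expectation (?post G) (?gain G) \<le> ?gain G \<tau>" for G
    using exists_ge_expectation[of "?gain G" 1 "?post G", OF gb] by blast
  then obtain t where t: "\<And>G. measure_pmf.expectation (?post G) (?gain G) \<le> ?gain G (t G)" by metis
  have pair: "measure_pmf.expectation (pair_pmf (?post G) (?post G)) (\<lambda>(x, y). overlap n x y)
      = measure_pmf.expectation (?post G) (?gain G)" for G
  proof -
    have "pair_pmf (?post G) (?post G) = bind_pmf (?post G) (\<lambda>y. map_pmf (\<lambda>x. (x, y)) (?post G))"
      unfolding pair_pmf_def map_pmf_def by (rule bind_commute_pmf)
    moreover have "\<bar>case z of (x, y) \<Rightarrow> overlap n x y\<bar> \<le> 1" for z :: "(nat \<Rightarrow> 'q) \<times> (nat \<Rightarrow> 'q)" using ob by (cases z) simp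
    ultimately show ?thesis by (simp add: expectation_bind_bounded[where B = 1])
  qed
  have "measure_pmf.expectation (Rep n) (\<lambda>(x, y). overlap n x y)
      = measure_pmf.expectation (map_pmf snd (J n)) (\<lambda>G. measure_pmf.expectation (?post G) (?gain G))"
    unfolding pair[symmetric] by (rule expectation_replicas[where B = 1]) (use ob in auto)
  also have "\<dots> \<le> measure_pmf.expectation (map_pmf snd (J n)) (\<lambda>G. ?gain G (t G))"
    by (intro integral_mono integrable_pmf_bounded[where B = 1] t abs_expectation_le gb ob)
  also have "\<dots> = measure_pmf.expectation (J n) (\<lambda>(\<sigma>, G). overlap n \<sigma> (t G))"
    by (rule expectation_posterior[where B = 1]) (rule ob)
  finally show ?thesis by blast
qed

text \<open>
  By \<open>near_trivial_of_max_alignment\<close>, the expected distance of \<open>R\<close> from \<open>\<pi>\<tau>\<^sup>T\<close> is bounded linearly by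
  the expected excess of the overlap over \<open>1/q\<close>, which recovery being impossible makes asymptotically
  nonpositive, and by frequency deviations of the first replica. The frequencies \<open>\<tau>\<close> of the second
  replica, itself distributed as the prior, are close to \<open>\<pi>\<close>.
\<close>

lemma recovery_impossible_imp_trivial_overlap:
  assumes recovery_impossible
  shows trivial_overlap
proof -
  obtain m where m: "m > 0" "\<And>i. m \<le> pmf \<pi> i" using prior_weight_bound by blast
  have "\<exists>t :: 'g \<Rightarrow> nat \<Rightarrow> 'q. n > 0 \<longrightarrow> measure_pmf.expectation (Rep n) (\<lambda>(x, y). overlap n x y)
           \<le> measure_pmf.expectation (J n) (\<lambda>(\<sigma>, G). overlap n \<sigma> (t G))" for n
    using exists_estimator_beating_replica by blast
  then obtain est :: "nat \<Rightarrow> 'g \<Rightarrow> nat \<Rightarrow> 'q" where est: "\<And>n. n > 0 \<Longrightarrow>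
      measure_pmf.expectation (Rep n) (\<lambda>(x, y). overlap n x y)
      \<le> measure_pmf.expectation (J n) (\<lambda>(\<sigma>, G). overlap n \<sigma> (est n G))" by metis
  let ?O = "\<lambda>n. measure_pmf.expectation (J n) (\<lambda>(\<sigma>, G). overlap n \<sigma> (est n G))"
  have O: "?O \<longlonglongrightarrow> 1 / CARD('q)" using assms by (auto simp: recovery_impossible_def)
  define dev where "dev n i = measure_pmf.expectation (map_pmf fst (J n)) (\<lambda>\<sigma>. \<bar>label_freq n \<sigma> i - pmf \<pi> i\<bar>)" for n i
  have dev: "(\<lambda>n. dev n i) \<longlonglongrightarrow> 0" for i unfolding dev_def by (rule label_freq_concentration)
  let ?H = "\<lambda>n. (\<Sum>k\<in>UNIV. dev n k) / m"
  let ?e = "\<lambda>n. \<Sum>i\<in>(UNIV::'q set). \<Sum>j\<in>UNIV.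
      (CARD('q) * (fact CARD('q) * (?O n - 1 / CARD('q) + 2 * ?H n)) + 2 * ?H n) + dev n j"
  show ?thesis unfolding trivial_overlap_def
  proof (rule tendsto_sandwich[OF _ _ tendsto_const])
    show "\<forall>\<^sub>F n in sequentially. measure_pmf.expectation (Rep n) (discrepancy n) \<le> ?e n"
      using eventually_gt_at_top[of 0]
    proof eventually_elim
      case (elim n)
      let ?E = "measure_pmf.expectation (Rep n)"
      let ?f = "\<lambda>x i. \<bar>label_freq n x i - pmf \<pi> i\<bar>"
      let ?b = "\<lambda>x y. CARD('q) * (fact CARD('q) * (overlap n x y - 1 / CARD('q) + 2 * ((\<Sum>k\<in>UNIV. ?f x k) / m)))
                 + 2 * ((\<Sum>k\<in>UNIV. ?f x k) / m)"
      have "?E (discrepancy n) \<le> ?E (\<lambda>(x, y). \<Sum>i\<in>(UNIV::'q set). \<Sum>j\<in>UNIV. ?b x y + ?f y j)"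
      proof (intro integral_mono integrable_Rep elim)
        fix z :: "(nat \<Rightarrow> 'q) \<times> (nat \<Rightarrow> 'q)"
        obtain x y where z: "z = (x, y)" by (cases z)
        have "\<bar>overlap_matrix n x y i j - pmf \<pi> i * pmf \<pi> j\<bar> \<le> ?b x y + ?f y j" for i j
        proof -
          have "\<bar>overlap_matrix n x y i j - pmf \<pi> i * label_freq n y j\<bar> \<le> ?b x y"
            using near_trivial_of_max_alignment[of "overlap_matrix n x y" m "pmf \<pi>" i j,
                OF overlap_matrix_nonneg m(2) m(1) sum_pmf_prior]
            by (simp add: overlap_matrix_col_sum overlap_matrix_row_sum overlap_eq_max_alignment[OF elim])
          moreover have "\<bar>pmf \<pi> i * label_freq n y j - pmf \<pi> i * pmf \<pi> j\<bar> \<le> ?f y j"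
          proof -
            have "\<bar>pmf \<pi> i * label_freq n y j - pmf \<pi> i * pmf \<pi> j\<bar> = pmf \<pi> i * ?f y j"
              by (simp add: abs_mult flip: right_diff_distrib)
            also have "\<dots> \<le> 1 * ?f y j" by (intro mult_right_mono pmf_le_1) auto
            finally show ?thesis by simp
          qed
          ultimately show ?thesis by linarith
        qed
        thus "discrepancy n z \<le> (case z of (x, y) \<Rightarrow> \<Sum>i\<in>(UNIV::'q set). \<Sum>j\<in>UNIV. ?b x y + ?f y j)"
          unfolding z discrepancy_def prod.case by (intro sum_mono)
      qed
      also have "\<dots> = (\<Sum>i\<in>(UNIV::'q set). \<Sum>j\<in>UNIV. (CARD('q) * (fact CARD('q) *
           (?E (\<lambda>(x, y). overlap n x y) - 1 / CARD('q) + 2 * ((\<Sum>k\<in>UNIV. ?E (\<lambda>(x, y). ?f x k)) / m)))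
            + 2 * ((\<Sum>k\<in>UNIV. ?E (\<lambda>(x, y). ?f x k)) / m)) + ?E (\<lambda>(x, y). ?f y j))"
        using integrable_Rep[OF elim] by (simp add: case_prod_unfold)
      also have "\<dots> = (\<Sum>i\<in>(UNIV::'q set). \<Sum>j\<in>UNIV. (CARD('q) * (fact CARD('q) *
           (?E (\<lambda>(x, y). overlap n x y) - 1 / CARD('q) + 2 * ?H n)) + 2 * ?H n) + dev n j)"
        by (simp only: expectation_replicas_fst expectation_replicas_snd dev_def)
      also have "\<dots> \<le> ?e n"
        by (intro sum_mono add_mono order_refl mult_left_mono diff_right_mono est elim) auto
      finally show ?case .
    qed
    have "?e \<longlonglongrightarrow> (\<Sum>i\<in>(UNIV::'q set). \<Sum>j\<in>(UNIV::'q set).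
      (CARD('q) * (fact CARD('q) * (1 / CARD('q) - 1 / CARD('q) + 2 * ((\<Sum>k\<in>(UNIV::'q set). 0) / m)))
         + 2 * ((\<Sum>k\<in>(UNIV::'q set). 0) / m)) + 0)"
      by (intro tendsto_intros O dev) (use m in auto)
    thus "?e \<longlonglongrightarrow> 0" by simp
  qed (auto intro!: always_eventually Bochner_Integration.integral_nonneg discrepancy_nonneg)
qed

end

section \<open>The planted model is exchangeable\<close>

definition relabel :: "(nat \<Rightarrow> nat) \<Rightarrow> ('q, 'k) factor_graph \<Rightarrow> ('q, 'k) factor_graph" where
  "relabel g = map (\<lambda>(\<delta>, \<psi>). (g \<circ> \<delta>, \<psi>))"

lemma relabel_inverse: "f \<circ> g = id \<Longrightarrow> relabel f (relabel g G) = G"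
  by (induction G) (auto simp: relabel_def comp_assoc[symmetric])

lemma inj_relabel: "f \<circ> g = id \<Longrightarrow> inj (relabel g)"
  by (rule inj_on_inverseI[of _ "relabel f"]) (rule relabel_inverse)

text \<open>
  A clause sees only the labels of its own neighbours, so moving variables and labels together
  changes nothing.
\<close>

lemma graph_weight_relabel:
  assumes "f \<circ> g = id"
  shows "graph_weight (relabel g G) (\<sigma> \<circ> f) = graph_weight G \<sigma>"
proof (induction G)
  case (Cons c G)
  have "f (g v) = v" for v using assms by (metis comp_apply id_apply)
  with Cons show ?case by (simp add: graph_weight_def relabel_def case_prod_unfold o_def)
qed (simp add: graph_weight_def relabel_def)

lemma map_replicate_pmf:
  "map_pmf (map h) (replicate_pmf m q) = replicate_pmf m (map_pmf h q)"
proof (induction m)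
  case (Suc m)
  have "map_pmf (map h) (replicate_pmf (Suc m) q)
      = bind_pmf q (\<lambda>x. bind_pmf (replicate_pmf m q) (\<lambda>xs. return_pmf (h x # map h xs)))"
    by (simp add: map_bind_pmf)
  also have "\<dots> = bind_pmf (map_pmf h q) (\<lambda>x. bind_pmf (map_pmf (map h) (replicate_pmf m q)) (\<lambda>xs. return_pmf (x # xs)))"
    by (simp add: bind_map_pmf)
  finally show ?case by (simp add: Suc.IH)
qed simp

lemma null_model_relabel:
  fixes p :: "('q::finite, 'k::finite) weight_fun pmf"
  assumes n: "n > 0" and g: "g permutes {..<n}"
  shows "map_pmf (relabel g) (null_model n m p) = null_model n m p"
proof -
  let ?D = "{\<delta> :: 'k \<Rightarrow> nat. range \<delta> \<subseteq> {..<n}}"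
  have "?D = (\<Pi>\<^sub>E i\<in>UNIV. {..<n})" by (auto simp: PiE_def Pi_def)
  hence D: "finite ?D" "?D \<noteq> {}"
    using n by (auto intro!: finite_PiE exI[of _ "\<lambda>_. 0"])
  have gf: "g v < n" if "v < n" for v using permutes_in_image[OF g, of v] that by simp
  have ginv: "inv g v < n" if "v < n" for v using permutes_in_image[OF permutes_inv[OF g], of v] that by simp
  have "bij_betw ((\<circ>) g) ?D ?D"
  proof (rule bij_betw_byWitness[where f' = "(\<circ>) (inv g)"])
    show "\<forall>\<delta>\<in>?D. inv g \<circ> (g \<circ> \<delta>) = \<delta>" "\<forall>\<delta>\<in>?D. g \<circ> (inv g \<circ> \<delta>) = \<delta>"
      by (auto simp: fun_eq_iff permutes_inverses[OF g])
  qed (use gf ginv in \<open>auto simp: image_subset_iff\<close>)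
  from map_pmf_of_set_bij_betw[OF this D(2,1)]
  have "map_pmf (\<lambda>(\<delta>, \<psi>). (g \<circ> \<delta>, \<psi>)) (pair_pmf (pmf_of_set ?D) p) = pair_pmf (pmf_of_set ?D) p"
    using map_pair[of "(\<circ>) g" "\<lambda>\<psi>. \<psi>" "pmf_of_set ?D" p] by simp
  thus ?thesis by (simp add: null_model_def relabel_def map_replicate_pmf)
qed

context
  fixes p :: "('q::finite, 'k::finite) weight_fun pmf" and \<pi> :: "'q pmf" and n :: nat and d :: real and f :: "nat \<Rightarrow> nat"
  assumes n: "n > 0" and fin: "finite (set_pmf p)" and pos: "\<And>\<psi> s. \<psi> \<in> set_pmf p \<Longrightarrow> \<psi> s > 0"
    and f: "f permutes {..<n}"
begin

text \<open>
  Both the null model and, by invariance of weights and null model together, the normalising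
  constant are unchanged when variables and labels are renamed consistently.
\<close>

lemma planted_graph_relabel:
  "map_pmf (relabel (inv f)) (planted_graph n m p \<sigma>) = planted_graph n m p (\<sigma> \<circ> f)"
proof (rule pmf_eqI)
  fix H :: "('q, 'k) factor_graph"
  define G where "G = relabel f H"
  have H: "H = relabel (inv f) G"
    unfolding G_def by (rule relabel_inverse[symmetric]) (rule permutes_inv_o(2)[OF f])
  have ff: "f \<circ> inv f = id" by (rule permutes_inv_o(1)[OF f])
  note inj = inj_relabel[OF ff]
  have density: "pmf (planted_graph n m p \<sigma>) g = pmf (null_model n m p) g * graph_weight g \<sigma>
      / measure_pmf.expectation (null_model n m p) (\<lambda>G. graph_weight G \<sigma>)" for \<sigma> g
    by (rule pmf_planted_graph) (use n fin pos in auto)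
  have null: "map_pmf (relabel (inv f)) (null_model n m p) = null_model n m p"
    by (rule null_model_relabel[OF n permutes_inv[OF f]])
  have "pmf (null_model n m p) H = pmf (map_pmf (relabel (inv f)) (null_model n m p)) H"
    by (simp only: null)
  also have "\<dots> = pmf (null_model n m p) G" unfolding H by (rule pmf_map_inj'[OF inj])
  finally have 1: "pmf (null_model n m p) H = pmf (null_model n m p) G" .
  have "measure_pmf.expectation (null_model n m p) (\<lambda>G. graph_weight G (\<sigma> \<circ> f))
      = measure_pmf.expectation (map_pmf (relabel (inv f)) (null_model n m p)) (\<lambda>G. graph_weight G (\<sigma> \<circ> f))"
    by (simp only: null)
  also have "\<dots> = measure_pmf.expectation (null_model n m p) (\<lambda>G. graph_weight G \<sigma>)"
    by (simp add: graph_weight_relabel[OF ff])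
  finally have 2: "measure_pmf.expectation (null_model n m p) (\<lambda>G. graph_weight G (\<sigma> \<circ> f))
      = measure_pmf.expectation (null_model n m p) (\<lambda>G. graph_weight G \<sigma>)" .
  have 3: "graph_weight H (\<sigma> \<circ> f) = graph_weight G \<sigma>"
    unfolding H by (rule graph_weight_relabel[OF ff])
  have "pmf (map_pmf (relabel (inv f)) (planted_graph n m p \<sigma>)) H = pmf (planted_graph n m p \<sigma>) G"
    unfolding H by (rule pmf_map_inj'[OF inj])
  also have "\<dots> = pmf (planted_graph n m p (\<sigma> \<circ> f)) H"
    by (simp only: density 1 2 3)
  finally show "pmf (map_pmf (relabel (inv f)) (planted_graph n m p \<sigma>)) H = pmf (planted_graph n m p (\<sigma> \<circ> f)) H" .
qed

lemma planted_model_relabel: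
  "map_pmf (\<lambda>(\<sigma>, G). (\<sigma> \<circ> f, relabel (inv f) G)) (planted_model n d p \<pi>) = planted_model n d p \<pi>"
proof -
  let ?prior = "Pi_pmf {..<n} undefined (\<lambda>_. \<pi>)"
  let ?rest = "\<lambda>\<sigma>. bind_pmf (poisson_pmf (d * real n / real CARD('k))) (\<lambda>m. map_pmf (Pair \<sigma>) (planted_graph n m p \<sigma>))"
  have model: "planted_model n d p \<pi> = bind_pmf ?prior ?rest"
    by (simp add: planted_model_def map_pmf_def)
  have "?prior = map_pmf (\<lambda>\<sigma>. \<sigma> \<circ> f) ?prior"
  proof (rule Pi_pmf_bij_betw)
    show "f v \<notin> {..<n}" if "v \<notin> {..<n}" for v using permutes_in_image[OF f, of v] that by simp
  qed (use f in \<open>simp_all add: permutes_imp_bij\<close>)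
  hence prior: "map_pmf (\<lambda>\<sigma>. \<sigma> \<circ> f) ?prior = ?prior" by simp
  have "map_pmf (\<lambda>(\<sigma>, G). (\<sigma> \<circ> f, relabel (inv f) G)) (planted_model n d p \<pi>)
      = bind_pmf ?prior (\<lambda>\<sigma>. bind_pmf (poisson_pmf (d * real n / real CARD('k)))
          (\<lambda>m. map_pmf (Pair (\<sigma> \<circ> f)) (map_pmf (relabel (inv f)) (planted_graph n m p \<sigma>))))"
    by (simp add: model map_bind_pmf pmf.map_comp o_def)
  also have "\<dots> = bind_pmf ?prior (\<lambda>\<sigma>. ?rest (\<sigma> \<circ> f))"
    by (simp only: planted_graph_relabel)
  also have "\<dots> = bind_pmf (map_pmf (\<lambda>\<sigma>. \<sigma> \<circ> f) ?prior) ?rest"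
    by (simp only: bind_map_pmf)
  finally show ?thesis by (simp only: prior model)
qed

end

lemma exchangeable_labelling_planted_model:
  fixes p :: "('q::finite, 'k::finite) weight_fun pmf"
  assumes "finite (set_pmf p)" "\<And>\<psi> s. \<psi> \<in> set_pmf p \<Longrightarrow> \<psi> s > 0" "\<And>i. pmf \<pi> i > 0"
  shows "exchangeable_labelling (\<lambda>n. planted_model n d p \<pi>) \<pi>"
proof
  fix n :: nat
  show "map_pmf fst (planted_model n d p \<pi>) = Pi_pmf {..<n} undefined (\<lambda>_. \<pi>)"
    by (simp add: planted_model_def map_bind_pmf bind_return_pmf')
  fix f assume n: "n > 0" and f: "f permutes {..<n}"
  show "\<exists>T. inj T \<and> map_pmf (\<lambda>(\<sigma>, G). (\<sigma> \<circ> f, T G)) (planted_model n d p \<pi>) = planted_model n d p \<pi>"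
  proof (intro exI conjI)
    show "map_pmf (\<lambda>(\<sigma>, G). (\<sigma> \<circ> f, relabel (inv f) G)) (planted_model n d p \<pi>) = planted_model n d p \<pi>"
      by (rule planted_model_relabel) (use n f assms in auto)
    show "inj (relabel (inv f) :: ('q, 'k) factor_graph \<Rightarrow> _)"
      by (rule inj_relabel) (rule permutes_inv_o(1)[OF f])
  qed
qed (use assms in auto)

section \<open>The equivalences\<close>

theorem theorem2p10:
  fixes \<pi> :: "'q::finite pmf"
    and \<Psi> :: "('q, 'k::finite) weight_fun set"
    and p :: "('q, 'k) weight_fun pmf"
    and d :: real
  assumes "CARD('q) \<ge> 2" and "CARD('k) \<ge> 2" and "d > 0"
    and "\<And>i. pmf \<pi> i > 0"
    and "finite \<Psi>" and "\<And>\<psi> s. \<psi> \<in> \<Psi> \<Longrightarrow> \<psi> s > 0" and "set_pmf p = \<Psi>"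
    and "\<And>\<psi> \<theta>. \<psi> \<in> \<Psi> \<Longrightarrow> \<theta> permutes UNIV \<Longrightarrow>
           (\<lambda>s. \<psi> (s \<circ> \<theta>)) \<in> \<Psi> \<and> pmf p (\<lambda>s. \<psi> (s \<circ> \<theta>)) = pmf p \<psi>"
  defines "a \<equiv> weak_recovery_impossible d p \<pi>"
    and "b \<equiv> (\<forall>u v i j. distinct_variables u v \<longrightarrow>
           tendsto_in_prob (\<lambda>n. G_plant n d p \<pi>)
             (\<lambda>n G. measure_pmf.prob (posterior n d p \<pi> G) {\<sigma>. \<sigma> (u n) = i \<and> \<sigma> (v n) = j})
             (pmf \<pi> i * pmf \<pi> j))"
    and "c \<equiv> (\<forall>u v. distinct_variables u v \<longrightarrow>
           tendsto_in_prob (\<lambda>n. G_plant n d p \<pi>)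
             (\<lambda>n G. measure_pmf.prob (posterior n d p \<pi> G) {\<sigma>. \<sigma> (u n) = \<sigma> (v n)})
             (\<Sum>i\<in>UNIV. (pmf \<pi> i)\<^sup>2) \<and>
           tendsto_in_prob (\<lambda>n. G_plant n d p \<pi>)
             (\<lambda>n G. \<Sum>i\<in>UNIV. pmf \<pi> i * measure_pmf.prob (posterior n d p \<pi> G) {\<sigma>. \<sigma> (u n) = i})
             (\<Sum>i\<in>UNIV. (pmf \<pi> i)\<^sup>2))"
    and "e \<equiv> (\<lambda>n. measure_pmf.expectation (G_plant n d p \<pi>) (\<lambda>G.
             measure_pmf.expectation (pair_pmf (posterior n d p \<pi> G) (posterior n d p \<pi> G))
               (\<lambda>(\<sigma>1, \<sigma>2). \<Sum>i\<in>UNIV. \<Sum>j\<in>UNIV.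
                  \<bar>overlap_matrix n \<sigma>1 \<sigma>2 i j - pmf \<pi> i * pmf \<pi> j\<bar>)))
           \<longlonglongrightarrow> 0"
  shows "(a \<longleftrightarrow> b) \<and> (b \<longleftrightarrow> c) \<and> (c \<longleftrightarrow> e)"
proof -
  interpret exchangeable_labelling "\<lambda>n. planted_model n d p \<pi>" \<pi>
    by (rule exchangeable_labelling_planted_model) (use assms in auto)
  have post: "posterior n d p \<pi> G = posterior_of (planted_model n d p \<pi>) G" for n G
    by (simp add: posterior_def posterior_of_def)
  have G: "G_plant n d p \<pi> = map_pmf snd (planted_model n d p \<pi>)" for n
    by (simp add: G_plant_def)
  have a: "a \<longleftrightarrow> recovery_impossible"
    by (simp add: a_def weak_recovery_impossible_def recovery_impossible_def)
  have e: "e \<longleftrightarrow> trivial_overlap"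
  proof -
    have "measure_pmf.expectation (G_plant n d p \<pi>) (\<lambda>G.
             measure_pmf.expectation (pair_pmf (posterior n d p \<pi> G) (posterior n d p \<pi> G))
               (\<lambda>(\<sigma>1, \<sigma>2). \<Sum>i\<in>UNIV. \<Sum>j\<in>UNIV.
                  \<bar>overlap_matrix n \<sigma>1 \<sigma>2 i j - pmf \<pi> i * pmf \<pi> j\<bar>))
        = measure_pmf.expectation (Rep n) (discrepancy n)" if "n > 0" for n
      unfolding G post discrepancy_def[symmetric]
      by (rule expectation_replicas[symmetric, where B = 2]) (rule discrepancy_le_2[OF that])
    thus ?thesis unfolding e_def trivial_overlap_def
      by (intro tendsto_cong eventually_mono[OF eventually_gt_at_top[of 0]]) auto
  qed
  define u0 v0 :: "nat \<Rightarrow> nat" where "u0 n = 0" and "v0 n = 1" for n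
  have uv: "distinct_variables u0 v0" by (auto simp: distinct_variables_def u0_def v0_def)
  have "a \<longleftrightarrow> e" unfolding a e
    using recovery_impossible_imp_trivial_overlap trivial_overlap_imp_recovery_impossible by blast
  moreover have "b \<Longrightarrow> c" unfolding b_def c_def G post
    using pair_posterior_imp_collision by blast
  moreover have "c \<Longrightarrow> e" unfolding e c_def G post
    using collision_imp_trivial_overlap[OF uv] uv by blast
  moreover have "e \<Longrightarrow> b" unfolding e b_def G post
    using trivial_overlap_imp_pair_posterior by blast
  ultimately show ?thesis by blast
qed

end
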